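(* For every real $\lambda > \lambda^*$ and every $\varepsilon > 0$, there exists a $3$-colorable (unsigned) graph $G$ such that its smallest adjacency eigenvalue satisfies $\lambda_1(G) \in (-\lambda - \varepsilon, -\lambda)$. Here $\lambda^* := \rho^{1/2} + \rho^{-1/2} \approx 2.01980$, where $\rho$ is the unique real root of $x^3 = 1 + x$.
   Context: For a finite simple graph $G$, $\lambda_1(G)$ denotes the smallest eigenvalue of its adjacency matrix. $3$-colorable has its usual meaning (proper vertex coloring with $3$ colors). *)

theory Defs
  imports
    Complex_Main
    "Graph_Theory.Pair_Digraph"
    "Jordan_Normal_Form.Spectral_Radius"
begin

text \<open>
  Finite simple graphs are rendered by the locale \<^locale>\<open>pair_graph\<close>: a finite vertex set
  with a symmetric, irreflexive set of ordered pairs on it.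
\<close>

definition proper_coloring :: "'a pair_pre_digraph \<Rightarrow> nat \<Rightarrow> ('a \<Rightarrow> nat) \<Rightarrow> bool" where
  "proper_coloring G k c \<longleftrightarrow>
     (\<forall>v \<in> pverts G. c v < k) \<and> (\<forall>(u, v) \<in> parcs G. c u \<noteq> c v)"

definition colorable :: "nat \<Rightarrow> 'a pair_pre_digraph \<Rightarrow> bool" where
  "colorable k G \<longleftrightarrow> (\<exists>c. proper_coloring G k c)"

text \<open>
  Rows and columns are indexed by the vertices in increasing order; any other enumeration
  gives a permutation-similar matrix.
\<close>

definition adjacency_mat :: "'a::linorder pair_pre_digraph \<Rightarrow> real mat" where
  "adjacency_mat G =
     (let vs = sorted_list_of_set (pverts G); n = length vs
      in mat n n (\<lambda>(i, j). if (vs ! i, vs ! j) \<in> parcs G then 1 else 0))"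

text \<open>
  The adjacency matrix is real symmetric, so all its eigenvalues are real.
  For the graph without vertices the spectrum is empty and the value is unspecified.
\<close>

definition smallest_eigenvalue :: "'a::linorder pair_pre_digraph \<Rightarrow> real" where
  "smallest_eigenvalue G = Min {x. eigenvalue (adjacency_mat G) x}"

lemma finite_eigenvalues_adjacency_mat:
  "finite {x. eigenvalue (adjacency_mat G) x}"
proof -
  have "adjacency_mat G \<in> carrier_mat (dim_row (adjacency_mat G)) (dim_row (adjacency_mat G))"
    by (auto simp: adjacency_mat_def Let_def)
  from card_finite_spectrum(1)[OF this] show ?thesis
    by (simp add: spectrum_def)
qed

definition rho :: real where
  "rho = (THE x. x ^ 3 = 1 + x)"

lemma ex1_rho: "\<exists>!x::real. x ^ 3 = 1 + x"
proof (rule ex_ex1I)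
  have "\<exists>x::real. 1 \<le> x \<and> x \<le> 2 \<and> x ^ 3 - x = 1"
    by (rule IVT') (auto intro!: continuous_intros)
  then show "\<exists>x::real. x ^ 3 = 1 + x"
    by (auto simp: algebra_simps)
next
  have gt1: "1 < z" if z: "z ^ 3 = 1 + z" for z :: real
  proof (rule ccontr)
    assume "\<not> 1 < z"
    have *: "z * (z - 1) * (z + 1) = 1"
      using z by (simp add: power3_eq_cube algebra_simps)
    show False
    proof (cases "z \<le> - 1")
      case True
      have "0 \<le> (z - 1) * (z + 1)"
        using True by (intro mult_nonpos_nonpos) auto
      then have "z * ((z - 1) * (z + 1)) \<le> 0"
        using True by (intro mult_nonpos_nonneg) auto
      with * show False by (simp add: mult.assoc)
    next
      case False
      have "z ^ 2 \<le> 1"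
        using False \<open>\<not> 1 < z\<close> by (simp add: abs_square_le_1 abs_le_iff)
      then have "\<bar>z\<bar> \<le> 1" "\<bar>1 - z ^ 2\<bar> \<le> 1"
        using False \<open>\<not> 1 < z\<close> by auto
      moreover have "(- z) * (1 - z ^ 2) = 1"
        using z by (simp add: power3_eq_cube power2_eq_square algebra_simps)
      then have "\<bar>z\<bar> * \<bar>1 - z ^ 2\<bar> = 1"
        by (metis abs_minus_cancel abs_mult abs_one)
      ultimately have "\<bar>z\<bar> = 1"
        by (smt (verit) mult_left_le abs_ge_zero)
      then have "z ^ 2 = 1" by (metis power2_abs one_power2)
      with \<open>(- z) * (1 - z ^ 2) = 1\<close> show False by simp
    qed
  qed
  fix x y :: real
  assume x: "x ^ 3 = 1 + x" and y: "y ^ 3 = 1 + y"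
  have "(x - y) * (x ^ 2 + x * y + y ^ 2 - 1) = 0"
    using x y by (simp add: power3_eq_cube power2_eq_square algebra_simps)
  moreover have "1 < x ^ 2" "1 < y ^ 2" "0 < x * y"
    using gt1[OF x] gt1[OF y] by (auto intro: one_less_power)
  ultimately show "x = y" by auto
qed

definition lambda_star :: real where
  "lambda_star = rho powr (1 / 2) + rho powr (- 1 / 2)"

end

theory Submission
  imports Defs "HOL-Analysis.Function_Topology"
begin

text \<open>
  Root a graph at a vertex \<open>r\<close> and eliminate all other vertices from \<open>A + l I\<close>; the remaining pivot
  \<open>d\<close> decides whether \<open>-l\<close> lies below the spectrum. Attaching a new root by a pendant edge changes
  \<open>d\<close> to \<open>l - 1 / d\<close>, a leaf at the root subtracts \<open>1 / l\<close>, and a triangle whose third vertex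
  carries a leaf gives a third map. All graphs built in this way are 2-degenerate, hence 3-colorable.

  Write \<open>l = t + 1 / t\<close>. If \<open>d < 1 / t\<close>, a long pendant path makes the pivot negative, and if
  \<open>d \<ge> 1 / t\<close>, it never does. Run the same construction at two levels \<open>l < l'\<close> with pivots
  \<open>d < d'\<close>, always taking the strongest step that keeps \<open>d\<close> above \<open>1 / t\<close>. If some step brings
  \<open>d\<close> down to \<open>1 / t\<close> but keeps \<open>d'\<close> above \<open>1 / t'\<close>, the least eigenvalue is caught between
  \<open>-l'\<close> and \<open>-l\<close>. Otherwise the pivots stay in a region where the steps expand, which is absurd.

  For \<open>t^4 - t^2 - 1 > 0\<close> pendant steps and leaves suffice, as in Shearer's theorem on spectral radii
  of caterpillars; the expansion is then visible in the cross ratio with the fixed points of the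
  pendant step. Between \<open>lambda_star\<close> and that range pendant steps and triangles expand in the usual
  metric. There the start is a path ending in a vertex with a leaf, and the shorter one is admissible
  exactly when \<open>t^2 > rho\<close>.
\<close>

section \<open>Rayleigh quotients\<close>

text \<open>The arcs contain both orientations of each edge, so on a \<open>pair_graph\<close> this
  is the quadratic form of the adjacency matrix plus \<open>m\<close> times the identity; its sign
  compares the spectrum with \<open>- m\<close>.\<close>

definition quad :: "'a pair_pre_digraph \<Rightarrow> real \<Rightarrow> ('a \<Rightarrow> real) \<Rightarrow> real" where
  "quad G m x = (\<Sum>(u, v)\<in>parcs G. x u * x v) + m * (\<Sum>v\<in>pverts G. (x v)\<^sup>2)"

lemma pair_graph_iff:
  "pair_graph G \<longleftrightarrow> finite (pverts G) \<and> parcs G \<subseteq> pverts G \<times> pverts G \<and> sym (parcs G) \<and> irrefl (parcs G)"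
proof
  assume "pair_graph G"
  then interpret pair_graph G .
  show "finite (pverts G) \<and> parcs G \<subseteq> pverts G \<times> pverts G \<and> sym (parcs G) \<and> irrefl (parcs G)"
  proof (intro conjI)
    show "parcs G \<subseteq> pverts G \<times> pverts G"
      using in_arcsD1 in_arcsD2 by auto
    show "sym (parcs G)"
      using pair_sym_arcs by (simp add: symmetric_def)
    show "irrefl (parcs G)"
      unfolding irrefl_def using pair_no_loops[of "(a, a)" for a] by auto
  qed (rule pair_finite_verts)
next
  assume *: "finite (pverts G) \<and> parcs G \<subseteq> pverts G \<times> pverts G \<and> sym (parcs G) \<and> irrefl (parcs G)"
  then have "finite (parcs G)"
    by (meson finite_SigmaI finite_subset)
  with * show "pair_graph G"
    by unfold_locales (auto simp: symmetric_def dest: irreflD)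
qed

lemma sum_parcs:
  assumes "pair_graph G"
  shows "(\<Sum>(u, v)\<in>parcs G. f u v) = (\<Sum>u\<in>pverts G. \<Sum>v | (u, v) \<in> parcs G. f u v)"
proof -
  have fin: "finite (pverts G)" and sub: "parcs G \<subseteq> pverts G \<times> pverts G"
    using assms by (auto simp: pair_graph_iff)
  have "parcs G = Sigma (pverts G) (\<lambda>u. {v. (u, v) \<in> parcs G})"
    using sub by auto
  moreover have "finite {v. (u, v) \<in> parcs G}" for u
    using sub by (intro finite_subset[OF _ fin]) auto
  ultimately show ?thesis
    using fin by (simp add: sum.Sigma)
qed

text \<open>The enumeration \<open>vs\<close> is a bijection between indices and vertices.
  Eigenvectors become functions on the vertices here, and no later argument unfolds the
  matrix.\<close>

lemma eigenvalue_adjacency_mat_iff: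
  fixes G :: "'a::linorder pair_pre_digraph"
  assumes "pair_graph G"
  shows "eigenvalue (adjacency_mat G) m \<longleftrightarrow>
    (\<exists>x. (\<exists>w\<in>pverts G. x w \<noteq> 0) \<and> (\<forall>w\<in>pverts G. (\<Sum>u | (w, u) \<in> parcs G. x u) = m * x w))"
    (is "?L \<longleftrightarrow> ?R")
proof -
  define vs where "vs = sorted_list_of_set (pverts G)"
  define n where "n = length vs"
  have fin: "finite (pverts G)" and sub: "parcs G \<subseteq> pverts G \<times> pverts G"
    using assms by (auto simp: pair_graph_iff)
  have set_vs: "set vs = pverts G" and "distinct vs"
    using fin by (auto simp: vs_def)
  then have bij: "bij_betw ((!) vs) {..<n} (pverts G)"
    unfolding n_def by (intro bij_betw_nth) auto
  have A: "adjacency_mat G = mat n n (\<lambda>(i, j). if (vs ! i, vs ! j) \<in> parcs G then 1 else 0)"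
    by (simp add: adjacency_mat_def vs_def n_def Let_def)
  have dim: "dim_row (adjacency_mat G) = n"
    by (simp add: A)
  have mult: "(adjacency_mat G *\<^sub>v vec n (\<lambda>j. x (vs ! j))) $ i = (\<Sum>u | (vs ! i, u) \<in> parcs G. x u)"
    if "i < n" for x i
  proof -
    have "(adjacency_mat G *\<^sub>v vec n (\<lambda>j. x (vs ! j))) $ i =
        (\<Sum>j<n. if (vs ! i, vs ! j) \<in> parcs G then x (vs ! j) else 0)"
      using that by (auto simp: A scalar_prod_def atLeast0LessThan intro!: sum.cong)
    also have "\<dots> = (\<Sum>u\<in>pverts G. if (vs ! i, u) \<in> parcs G then x u else 0)"
      by (rule sum.reindex_bij_betw[OF bij])
    also have "\<dots> = (\<Sum>u\<in>{u \<in> pverts G. (vs ! i, u) \<in> parcs G}. x u)"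
      using fin by (simp add: sum.If_cases Int_def)
    also have "{u \<in> pverts G. (vs ! i, u) \<in> parcs G} = {u. (vs ! i, u) \<in> parcs G}"
      using sub by auto
    finally show ?thesis .
  qed
  have vs_in: "vs ! i \<in> pverts G" if "i < n" for i
    using that nth_mem[of i vs] unfolding set_vs n_def by simp
  have ev: "eigenvector (adjacency_mat G) (vec n (\<lambda>j. x (vs ! j))) m \<longleftrightarrow>
      (\<exists>w\<in>pverts G. x w \<noteq> 0) \<and> (\<forall>w\<in>pverts G. (\<Sum>u | (w, u) \<in> parcs G. x u) = m * x w)" for x
  proof -
    have all: "(\<forall>w\<in>pverts G. P w) \<longleftrightarrow> (\<forall>i<n. P (vs ! i))" for P
      unfolding set_vs[symmetric] n_def by (rule all_set_conv_all_nth)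
    have "vec n (\<lambda>j. x (vs ! j)) = 0\<^sub>v n \<longleftrightarrow> (\<forall>w\<in>pverts G. x w = 0)"
      unfolding all by (subst vec_eq_iff) simp
    moreover have "adjacency_mat G *\<^sub>v vec n (\<lambda>j. x (vs ! j)) = m \<cdot>\<^sub>v vec n (\<lambda>j. x (vs ! j)) \<longleftrightarrow>
        (\<forall>i<n. (adjacency_mat G *\<^sub>v vec n (\<lambda>j. x (vs ! j))) $ i = m * x (vs ! i))"
      by (subst vec_eq_iff) (simp add: dim)
    moreover have "\<dots> \<longleftrightarrow> (\<forall>w\<in>pverts G. (\<Sum>u | (w, u) \<in> parcs G. x u) = m * x w)"
      unfolding all by (simp add: mult)
    ultimately show ?thesis
      unfolding eigenvector_def dim by simp
  qed
  show ?thesis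
  proof
    assume ?L
    then obtain v where v: "eigenvector (adjacency_mat G) v m"
      unfolding eigenvalue_def ..
    then have "dim_vec v = n"
      unfolding eigenvector_def dim by (elim conjE carrier_vecD)
    have inj: "inj_on ((!) vs) {..<n}"
      using bij by (rule bij_betw_imp_inj_on)
    define x where "x w = v $ (the_inv_into {..<n} ((!) vs) w)" for w
    have "x (vs ! i) = v $ i" if "i < n" for i
      unfolding x_def using the_inv_into_f_f[OF inj, of i] that by simp
    then have "vec n (\<lambda>j. x (vs ! j)) = v"
      using \<open>dim_vec v = n\<close> by (intro eq_vecI) simp_all
    then have "eigenvector (adjacency_mat G) (vec n (\<lambda>j. x (vs ! j))) m"
      using v by (simp only:)
    then have "(\<exists>w\<in>pverts G. x w \<noteq> 0) \<and>
        (\<forall>w\<in>pverts G. (\<Sum>u | (w, u) \<in> parcs G. x u) = m * x w)"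
      by (rule iffD1[OF ev])
    then show ?R by (rule exI[of _ x])
  next
    assume ?R
    then obtain x where "(\<exists>w\<in>pverts G. x w \<noteq> 0) \<and>
        (\<forall>w\<in>pverts G. (\<Sum>u | (w, u) \<in> parcs G. x u) = m * x w)" by (rule exE)
    then have "eigenvector (adjacency_mat G) (vec n (\<lambda>j. x (vs ! j))) m"
      by (rule iffD2[OF ev])
    then show ?L
      unfolding eigenvalue_def by (rule exI)
  qed
qed

text \<open>The first-order condition at a minimum: for \<open>k > c\<close> the test point
  \<open>- b / k\<close> lets the linear term outweigh the quadratic one.\<close>

lemma linear_term_eq_0:
  fixes b c :: real
  assumes "\<And>e. 0 \<le> e * b + e\<^sup>2 * c"
  shows "b = 0"
proof (rule ccontr)
  assume "b \<noteq> 0"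
  define k where "k = \<bar>c\<bar> + 1"
  have k: "k > 0" "c < k" by (auto simp: k_def)
  have "0 \<le> (- b / k) * b + (- b / k)\<^sup>2 * c" by (rule assms)
  also have "\<dots> = b\<^sup>2 / k\<^sup>2 * (c - k)"
    using k by (simp add: field_simps power2_eq_square)
  also have "\<dots> < 0"
    using k \<open>b \<noteq> 0\<close> by (intro mult_pos_neg) auto
  finally show False by simp
qed

text \<open>A variational construction: the Rayleigh quotient attains its minimum \<open>m\<close>
  by compactness, and stationarity there is the eigenvalue equation.\<close>

lemma exists_least_eigenvalue:
  fixes G :: "'a::linorder pair_pre_digraph"
  assumes G: "pair_graph G" and "pverts G \<noteq> {}"
  shows "\<exists>m. eigenvalue (adjacency_mat G) m \<and> (\<forall>y. 0 \<le> quad G (- m) y)"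
proof -
  have fin: "finite (pverts G)" and sub: "parcs G \<subseteq> pverts G \<times> pverts G" and "sym (parcs G)"
    using assms by (auto simp: pair_graph_iff)
  define Q where "Q x = (\<Sum>(u, v)\<in>parcs G. x u * x v)" for x :: "'a \<Rightarrow> real"
  define N where "N x = (\<Sum>v\<in>pverts G. (x v)\<^sup>2)" for x :: "'a \<Rightarrow> real"
  \<comment> \<open>The type \<open>'a\<close> may be infinite. Fixing the coordinates off the graph
    to 0 makes \<open>B\<close> a product of compact sets, hence compact by Tychonoff.\<close>
  define B where "B = (PiE UNIV (\<lambda>i. if i \<in> pverts G then {-1..1} else {0}) :: ('a \<Rightarrow> real) set)"
  have "compact B"
    unfolding compactin_euclidean_iff[symmetric] euclidean_product_topology[symmetric] B_def compactin_PiE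
    by (auto simp: compactin_euclidean_iff)
  have cont: "continuous_on S (\<lambda>x. x i)" for S and i :: 'a
    by (rule continuous_on_subset[OF continuous_on_product_coordinates]) auto
  have contQ: "continuous_on S Q" and contN: "continuous_on S N" for S
    unfolding Q_def N_def case_prod_beta by (intro continuous_intros cont)+
  have "closed (N -` {1})"
    using continuous_closed_preimage[OF contN[of UNIV], of "{1}"] by simp
  with \<open>compact B\<close> have "compact (B \<inter> N -` {1})"
    by (rule compact_Int_closed)
  moreover obtain w0 where w0: "w0 \<in> pverts G"
    using assms by auto
  have "(\<lambda>i. if i = w0 then 1 else 0) \<in> B \<inter> N -` {1}"
    using w0 fin by (auto simp: B_def N_def if_distrib[of "\<lambda>x. x\<^sup>2"] cong: if_cong)
  ultimately obtain x where x: "x \<in> B" "N x = 1" and min: "\<And>y. y \<in> B \<Longrightarrow> N y = 1 \<Longrightarrow> Q x \<le> Q y"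
    using continuous_attains_inf[OF _ _ contQ, of "B \<inter> N -` {1}"] by blast
  define m where "m = Q x"
  have ge: "m * N y \<le> Q y" for y
  proof (cases "N y = 0")
    case True
    then have "\<forall>i\<in>pverts G. y i = 0"
      using fin by (simp add: N_def sum_nonneg_eq_0_iff)
    then have "Q y = 0"
      unfolding Q_def using sub by (auto intro!: sum.neutral)
    with True show ?thesis by simp
  next
    case False
    then have pos: "N y > 0"
      by (simp add: N_def order_less_le sum_nonneg)
    define z where "z i = (if i \<in> pverts G then y i / sqrt (N y) else 0)" for i
    have "N z = 1"
      using pos by (simp add: N_def z_def power_divide sum_divide_distrib[symmetric])
    moreover have "z \<in> B"
    proof -
      have "\<bar>z i\<bar> \<le> 1" if "i \<in> pverts G" for i
      proof -
        have "(z i)\<^sup>2 \<le> N z"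
          unfolding N_def using that fin by (intro member_le_sum) auto
        then show ?thesis
          using \<open>N z = 1\<close> by (simp add: abs_square_le_1)
      qed
      then show ?thesis
        by (simp add: B_def PiE_iff abs_le_iff minus_le_iff) (simp add: z_def)
    qed
    moreover have "Q z = Q y / N y"
    proof -
      have "Q z = (\<Sum>(u, v)\<in>parcs G. (y u * y v) / N y)"
        unfolding Q_def using sub pos by (intro sum.cong) (auto simp: z_def)
      then show ?thesis
        by (simp add: Q_def sum_divide_distrib case_prod_beta)
    qed
    ultimately have "m \<le> Q y / N y"
      using min[of z] by (simp add: m_def)
    with pos show ?thesis by (simp add: field_simps)
  qed
  have "(\<Sum>u | (w, u) \<in> parcs G. x u) = m * x w" if w: "w \<in> pverts G" for w
  proof -
    \<comment> \<open>\<open>Q - m * N\<close> is nonnegative and vanishes at \<open>x\<close>;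
      varying \<open>x\<close> in the coordinate \<open>w\<close> yields the eigenvalue equation at
      \<open>w\<close>.\<close>
    define h where "h i = (if i = w then 1 else 0 :: real)" for i
    define A where "A = (\<Sum>u | (w, u) \<in> parcs G. x u)"
    have hA: "(\<Sum>(u, v)\<in>parcs G. h u * x v) = A"
    proof -
      have "(\<Sum>(u, v)\<in>parcs G. h u * x v) = (\<Sum>u\<in>pverts G. h u * (\<Sum>v | (u, v) \<in> parcs G. x v))"
        unfolding sum_parcs[OF G] by (simp add: sum_distrib_left)
      also have "\<dots> = A"
        using w fin by (simp add: h_def A_def if_distrib[of "\<lambda>t. t * _"] sum.delta' cong: if_cong)
      finally show ?thesis .
    qed
    have swap: "(\<Sum>(u, v)\<in>parcs G. x u * h v) = (\<Sum>(u, v)\<in>parcs G. h u * x v)"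
      using \<open>sym (parcs G)\<close>
      by (intro sum.reindex_bij_witness[of _ prod.swap prod.swap]) (auto simp: sym_def)
    have "0 \<le> e * (2 * A - 2 * m * x w) + e\<^sup>2 * (Q h - m * N h)" for e
    proof -
      have "Q (\<lambda>i. x i + e * h i) = (\<Sum>(u, v)\<in>parcs G. x u * x v + e * (h u * x v) + e * (x u * h v) + e\<^sup>2 * (h u * h v))"
        unfolding Q_def by (intro sum.cong) (auto simp: algebra_simps power2_eq_square)
      also have "\<dots> = Q x + e * A + e * A + e\<^sup>2 * Q h"
        using hA swap by (simp add: Q_def sum.distrib sum_distrib_left[symmetric] case_prod_beta)
      finally have 1: "Q (\<lambda>i. x i + e * h i) = Q x + 2 * e * A + e\<^sup>2 * Q h" by simp
      have "(\<Sum>i\<in>pverts G. x i * h i) = x w"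
        using w fin by (simp add: h_def if_distrib[of "\<lambda>t. _ * t"] sum.delta' cong: if_cong)
      moreover have "N (\<lambda>i. x i + e * h i) = (\<Sum>i\<in>pverts G. (x i)\<^sup>2 + 2 * e * (x i * h i) + e\<^sup>2 * (h i)\<^sup>2)"
        unfolding N_def by (intro sum.cong) (auto simp: algebra_simps power2_eq_square)
      ultimately have 2: "N (\<lambda>i. x i + e * h i) = N x + 2 * e * x w + e\<^sup>2 * N h"
        by (simp add: N_def sum.distrib sum_distrib_left[symmetric])
      show ?thesis
        using ge[of "\<lambda>i. x i + e * h i"] x unfolding 1 2 by (simp add: algebra_simps m_def)
    qed
    from linear_term_eq_0[OF this] show ?thesis by (simp add: A_def)
  qed
  moreover have "\<exists>w\<in>pverts G. x w \<noteq> 0"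
    using \<open>N x = 1\<close> by (auto simp: N_def intro: ccontr)
  ultimately have "eigenvalue (adjacency_mat G) m"
    unfolding eigenvalue_adjacency_mat_iff[OF G] by blast
  moreover have "0 \<le> quad G (- m) y" for y
    using ge[of y] by (simp add: quad_def Q_def N_def)
  ultimately show ?thesis by blast
qed

text \<open>At the least eigenvalue \<open>k\<close> the form \<open>quad G (- k)\<close> is
  nonnegative on \<open>x\<close>; subtracting \<open>quad G m x\<close> leaves
  \<open>- k - m\<close> times a positive norm.\<close>

lemma smallest_eigenvalue_le:
  fixes G :: "'a::linorder pair_pre_digraph"
  assumes G: "pair_graph G" and w: "w \<in> pverts G" "x w \<noteq> 0" and "quad G m x \<le> 0"
  shows "smallest_eigenvalue G \<le> - m"
proof -
  obtain k where k: "eigenvalue (adjacency_mat G) k" "0 \<le> quad G (- k) x"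
    using exists_least_eigenvalue[OF G] w by auto
  have "finite (pverts G)" using G by (simp add: pair_graph_iff)
  then have "0 < (\<Sum>v\<in>pverts G. (x v)\<^sup>2)"
    using w by (intro sum_pos2) auto
  moreover have "0 \<le> (- k - m) * (\<Sum>v\<in>pverts G. (x v)\<^sup>2)"
    using k(2) \<open>quad G m x \<le> 0\<close> by (simp add: quad_def algebra_simps)
  ultimately have "k \<le> - m"
    by (simp add: zero_le_mult_iff)
  moreover have "smallest_eigenvalue G \<le> k"
    unfolding smallest_eigenvalue_def using k finite_eigenvalues_adjacency_mat by (intro Min_le) auto
  ultimately show ?thesis by simp
qed

text \<open>On an eigenvector of the smallest eigenvalue the form equals that eigenvalue plus
  \<open>m\<close>, times the squared norm.\<close>

lemma smallest_eigenvalue_ge: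
  fixes G :: "'a::linorder pair_pre_digraph"
  assumes G: "pair_graph G" and "pverts G \<noteq> {}" and nonneg: "\<And>y. 0 \<le> quad G m y"
  shows "- m \<le> smallest_eigenvalue G"
proof -
  have "{k. eigenvalue (adjacency_mat G) k} \<noteq> {}"
    using exists_least_eigenvalue[OF assms(1,2)] by auto
  then have "eigenvalue (adjacency_mat G) (smallest_eigenvalue G)"
    unfolding smallest_eigenvalue_def using Min_in[OF finite_eigenvalues_adjacency_mat] by blast
  then obtain x w where w: "w \<in> pverts G" "x w \<noteq> 0"
    and x: "\<And>w. w \<in> pverts G \<Longrightarrow> (\<Sum>u | (w, u) \<in> parcs G. x u) = smallest_eigenvalue G * x w"
    unfolding eigenvalue_adjacency_mat_iff[OF G] by blast
  have "finite (pverts G)" using G by (simp add: pair_graph_iff)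
  then have "0 < (\<Sum>v\<in>pverts G. (x v)\<^sup>2)"
    using w by (intro sum_pos2) auto
  moreover have "(\<Sum>(u, v)\<in>parcs G. x u * x v) = smallest_eigenvalue G * (\<Sum>v\<in>pverts G. (x v)\<^sup>2)"
  proof -
    have "(\<Sum>(u, v)\<in>parcs G. x u * x v) = (\<Sum>u\<in>pverts G. x u * (\<Sum>v | (u, v) \<in> parcs G. x v))"
      unfolding sum_parcs[OF G] by (simp add: sum_distrib_left)
    also have "\<dots> = (\<Sum>u\<in>pverts G. smallest_eigenvalue G * (x u)\<^sup>2)"
      by (intro sum.cong) (auto simp: x power2_eq_square)
    finally show ?thesis by (simp add: sum_distrib_left)
  qed
  ultimately show ?thesis
    using nonneg[of x] by (simp add: quad_def distrib_right[symmetric] zero_le_mult_iff)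
qed

section \<open>Schur complements of rooted graphs\<close>

definition add_vertex :: "'a pair_pre_digraph \<Rightarrow> 'a \<Rightarrow> 'a set \<Rightarrow> 'a pair_pre_digraph" where
  "add_vertex G v N = \<lparr>pverts = insert v (pverts G), parcs = parcs G \<union> {v} \<times> N \<union> N \<times> {v}\<rparr>"

lemma add_vertex_simps [simp]:
  "pverts (add_vertex G v N) = insert v (pverts G)"
  "parcs (add_vertex G v N) = parcs G \<union> {v} \<times> N \<union> N \<times> {v}"
  by (simp_all add: add_vertex_def)

section \<open>2-degenerate graphs and greedy 3-coloring\<close>

inductive two_degenerate :: "'a pair_pre_digraph \<Rightarrow> bool" where
  single: "two_degenerate \<lparr>pverts = {v}, parcs = {}\<rparr>"
| add: "two_degenerate G \<Longrightarrow> v \<notin> pverts G \<Longrightarrow> N \<subseteq> pverts G \<Longrightarrow> card N \<le> 2 \<Longrightarrow>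
    two_degenerate (add_vertex G v N)"

lemma two_degenerate_imp_pair_graph: "two_degenerate G \<Longrightarrow> pair_graph G"
  unfolding pair_graph_iff
  by (induction rule: two_degenerate.induct) (auto simp: sym_def irrefl_def)

text \<open>The neighbors \<open>N\<close> of the vertex added last use at most two of the three
  colors, so a coloring of the smaller graph extends.\<close>

lemma two_degenerate_imp_colorable:
  assumes "two_degenerate G"
  shows "colorable 3 G"
  using assms
proof (induction rule: two_degenerate.induct)
  case (single v)
  show ?case
    by (auto simp: colorable_def proper_coloring_def intro!: exI[of _ "\<lambda>_. 0"])
next
  case (add G v N)
  have G: "finite (pverts G)" "parcs G \<subseteq> pverts G \<times> pverts G"
    using two_degenerate_imp_pair_graph[OF add.hyps(1)] by (auto simp: pair_graph_iff)
  obtain c :: "'a \<Rightarrow> nat" where c: "\<And>w. w \<in> pverts G \<Longrightarrow> c w < 3" "\<And>u w. (u, w) \<in> parcs G \<Longrightarrow> c u \<noteq> c w"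
    using add.IH by (fastforce simp: colorable_def proper_coloring_def)
  have "finite N"
    using G add.hyps finite_subset by blast
  then have "card (c ` N) < card {..<3::nat}"
    using add.hyps card_image_le[of N c] by simp
  then have "\<not> {..<3} \<subseteq> c ` N"
    using \<open>finite N\<close> card_mono[of "c ` N" "{..<3}"] by auto
  then obtain k where k: "k < 3" "k \<notin> c ` N" by auto
  have "(c(v := k)) a \<noteq> (c(v := k)) b" if ab: "(a, b) \<in> parcs (add_vertex G v N)" for a b
  proof -
    from ab consider "(a, b) \<in> parcs G" | "a = v" "b \<in> N" | "a \<in> N" "b = v"
      by auto
    then show ?thesis
    proof cases
      case 1
      then have "a \<noteq> v" "b \<noteq> v" using G(2) add.hyps by auto
      with 1 c(2) show ?thesis by simp
    qed (use add.hyps k in auto)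
  qed
  then have "\<forall>(a, b)\<in>parcs (add_vertex G v N). (c(v := k)) a \<noteq> (c(v := k)) b"
    by blast
  moreover have "\<forall>a\<in>pverts (add_vertex G v N). (c(v := k)) a < 3"
    using c(1) k(1) by simp
  ultimately have "proper_coloring (add_vertex G v N) 3 (c(v := k))"
    unfolding proper_coloring_def by blast
  then show ?case by (auto simp: colorable_def)
qed

lemma quad_cong:
  assumes "pair_graph G" and "\<And>u. u \<in> pverts G \<Longrightarrow> x u = y u"
  shows "quad G m x = quad G m y"
proof -
  have "parcs G \<subseteq> pverts G \<times> pverts G"
    using assms by (simp add: pair_graph_iff)
  then have "(\<Sum>(u, v)\<in>parcs G. x u * x v) = (\<Sum>(u, v)\<in>parcs G. y u * y v)"
    using assms by (intro sum.cong) auto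
  then show ?thesis
    using assms by (simp add: quad_def)
qed

lemma quad_scale: "quad G m (\<lambda>u. c * x u) = c\<^sup>2 * quad G m x"
proof -
  have "(\<Sum>(u, v)\<in>parcs G. (c * x u) * (c * x v)) = c\<^sup>2 * (\<Sum>(u, v)\<in>parcs G. x u * x v)"
    by (simp add: sum_distrib_left case_prod_beta power2_eq_square mult_ac)
  moreover have "(\<Sum>v\<in>pverts G. (c * x v)\<^sup>2) = c\<^sup>2 * (\<Sum>v\<in>pverts G. (x v)\<^sup>2)"
    by (simp add: sum_distrib_left power_mult_distrib)
  ultimately show ?thesis
    by (simp add: quad_def algebra_simps)
qed

lemma quad_add_vertex:
  assumes G: "pair_graph G" and v: "v \<notin> pverts G" and N: "N \<subseteq> pverts G"
  shows "quad (add_vertex G v N) m x = quad G m x + m * (x v)\<^sup>2 + 2 * x v * (\<Sum>u\<in>N. x u)"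
proof -
  have fin: "finite (pverts G)" and sub: "parcs G \<subseteq> pverts G \<times> pverts G"
    using G by (auto simp: pair_graph_iff)
  have "finite N" using N fin finite_subset by blast
  have "finite (parcs G)" using sub fin by (meson finite_SigmaI finite_subset)
  define f where "f = (\<lambda>(u, w). x u * x w)"
  have "sum f (parcs G \<union> {v} \<times> N \<union> N \<times> {v}) = sum f (parcs G \<union> {v} \<times> N) + sum f (N \<times> {v})"
    using \<open>finite N\<close> \<open>finite (parcs G)\<close> sub v N by (intro sum.union_disjoint) auto
  moreover have "sum f (parcs G \<union> {v} \<times> N) = sum f (parcs G) + sum f ({v} \<times> N)"
    using \<open>finite N\<close> \<open>finite (parcs G)\<close> sub v N by (intro sum.union_disjoint) auto
  moreover have "sum f ({v} \<times> N) = x v * (\<Sum>u\<in>N. x u)"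
    unfolding f_def sum.cartesian_product[symmetric] by (simp add: sum_distrib_left)
  moreover have "sum f (N \<times> {v}) = x v * (\<Sum>u\<in>N. x u)"
    unfolding f_def sum.cartesian_product[symmetric] by (simp add: sum_distrib_left mult.commute)
  ultimately show ?thesis
    using v fin by (simp add: quad_def f_def algebra_simps)
qed

text \<open>
  For a graph with a root \<open>r\<close>, the minimum of the quadratic form over the vectors with \<open>x r = 1\<close>
  is the Schur complement at \<open>r\<close>. The number \<open>d\<close> bounds it from above at \<open>l\<close>, and \<open>d'\<close> bounds
  it from below at \<open>l'\<close>.
\<close>

definition attainable :: "real \<Rightarrow> real \<Rightarrow> real \<Rightarrow> real \<Rightarrow> bool" where
  "attainable l l' d d' \<longleftrightarrow> (\<exists>(G :: nat pair_pre_digraph) r. two_degenerate G \<and> r \<in> pverts G \<and>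
     (\<exists>x. x r = 1 \<and> quad G l x \<le> d) \<and> (\<forall>y. d' * (y r)\<^sup>2 \<le> quad G l' y))"

lemma attainable_single: "attainable l l' l l'"
proof -
  have "two_degenerate \<lparr>pverts = {0::nat}, parcs = {}\<rparr>"
    by (rule two_degenerate.single)
  then show ?thesis
    unfolding attainable_def
    by (intro exI[of _ "\<lparr>pverts = {0}, parcs = {}\<rparr>"] exI[of _ 0]) (auto simp: quad_def intro!: exI[of _ "\<lambda>_. 1"])
qed

text \<open>At level \<open>k\<close> the form loses \<open>l - k\<close> times the squared norm of
  the test function, which is at least \<open>(x r)^2 = 1\<close>.\<close>

lemma attainable_decrease:
  assumes "attainable l l' d d'" "k \<le> l"
  shows "attainable k l' (d - (l - k)) d'"
proof -
  obtain G :: "nat pair_pre_digraph" and r x where G: "two_degenerate G" "r \<in> pverts G" "x r = 1" "quad G l x \<le> d"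
    and lb: "\<And>y. d' * (y r)\<^sup>2 \<le> quad G l' y"
    using assms unfolding attainable_def by blast
  have "finite (pverts G)"
    using two_degenerate_imp_pair_graph[OF G(1)] by (simp add: pair_graph_iff)
  then have "(x r)\<^sup>2 \<le> (\<Sum>v\<in>pverts G. (x v)\<^sup>2)"
    using G by (intro member_le_sum) auto
  then have "(l - k) * 1 \<le> (l - k) * (\<Sum>v\<in>pverts G. (x v)\<^sup>2)"
    using assms G by (intro mult_left_mono) auto
  then have "quad G k x \<le> d - (l - k)"
    using G(4) by (simp add: quad_def algebra_simps)
  with G lb show ?thesis
    unfolding attainable_def by blast
qed

text \<open>Completing the square; each use eliminates one vertex in a lower bound for the form at
  \<open>l'\<close>.\<close>

lemma quadratic_lower_bound:
  fixes a b x :: real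
  assumes "a > 0"
  shows "- (b\<^sup>2 / a) \<le> a * x\<^sup>2 + 2 * b * x"
proof -
  have "a * x\<^sup>2 + 2 * b * x + b\<^sup>2 / a = a * (x + b / a)\<^sup>2"
    using assms by (simp add: field_simps power2_eq_square)
  also have "\<dots> \<ge> 0" using assms by simp
  finally show ?thesis by simp
qed

lemma attainable_leaf:
  assumes att: "attainable l l' d d'" and pos: "l > 0" "l' > 0"
  shows "attainable l l' (d - 1 / l) (d' - 1 / l')"
proof -
  obtain G :: "nat pair_pre_digraph" and r x where G: "two_degenerate G" "r \<in> pverts G" "x r = 1" "quad G l x \<le> d"
    and lb: "\<And>y. d' * (y r)\<^sup>2 \<le> quad G l' y"
    using att unfolding attainable_def by blast
  have pg: "pair_graph G" using two_degenerate_imp_pair_graph G by blast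
  then obtain v where v: "v \<notin> pverts G"
    using ex_new_if_finite infinite_UNIV_nat by (auto simp: pair_graph_iff)
  define H where "H = add_vertex G v {r}"
  have quad: "quad H m y = quad G m y + m * (y v)\<^sup>2 + 2 * y v * y r" for m y
    using quad_add_vertex[OF pg v, of "{r}"] G by (simp add: H_def)
  have "two_degenerate H"
    unfolding H_def using G v by (intro two_degenerate.add) auto
  moreover have "r \<in> pverts H" using G by (simp add: H_def)
  moreover have "\<exists>x. x r = 1 \<and> quad H l x \<le> d - 1 / l"
  proof -
    \<comment> \<open>The value \<open>- 1 / l\<close> minimises \<open>l * z^2 + 2 * z\<close>, the
      share of the leaf when the root has value 1.\<close>
    let ?x = "x(v := - 1 / l)"
    have "?x r = 1" using G v by auto
    have "quad G l ?x = quad G l x"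
      using v by (intro quad_cong[OF pg]) auto
    then have "quad H l ?x \<le> d - 1 / l"
      using G v pos unfolding quad by (auto simp: field_simps power2_eq_square)
    with \<open>?x r = 1\<close> show ?thesis by (intro exI[of _ ?x] conjI)
  qed
  moreover have "(d' - 1 / l') * (y r)\<^sup>2 \<le> quad H l' y" for y
    using quadratic_lower_bound[OF pos(2), of "y r" "y v"] lb[of y] unfolding quad
    by (simp add: algebra_simps)
  ultimately show ?thesis unfolding attainable_def by blast
qed

text \<open>The root moves to the new vertex. With value 1 there and \<open>a\<close> at the old
  root, the old graph and the edge contribute \<open>d * a^2 + 2 * a\<close>, whose minimum
  \<open>- 1 / d\<close> is taken at \<open>a = - 1 / d\<close>.\<close>

lemma attainable_pendant:
  assumes att: "attainable l l' d d'" and pos: "d > 0" "d' > 0"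
  shows "attainable l l' (l - 1 / d) (l' - 1 / d')"
proof -
  obtain G :: "nat pair_pre_digraph" and r x where G: "two_degenerate G" "r \<in> pverts G" "x r = 1" "quad G l x \<le> d"
    and lb: "\<And>y. d' * (y r)\<^sup>2 \<le> quad G l' y"
    using att unfolding attainable_def by blast
  have pg: "pair_graph G" using two_degenerate_imp_pair_graph G by blast
  then obtain v where v: "v \<notin> pverts G"
    using ex_new_if_finite infinite_UNIV_nat by (auto simp: pair_graph_iff)
  define H where "H = add_vertex G v {r}"
  have quad: "quad H m y = quad G m y + m * (y v)\<^sup>2 + 2 * y v * y r" for m y
    using quad_add_vertex[OF pg v, of "{r}"] G by (simp add: H_def)
  have "two_degenerate H"
    unfolding H_def using G v by (intro two_degenerate.add) auto
  moreover have "v \<in> pverts H" by (simp add: H_def)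
  moreover have "\<exists>x. x v = 1 \<and> quad H l x \<le> l - 1 / d"
  proof -
    let ?x = "(\<lambda>u. - (1 / d) * x u)(v := 1)"
    have "?x v = 1" by simp
    have "quad G l ?x = quad G l (\<lambda>u. - (1 / d) * x u)"
      using v by (intro quad_cong[OF pg]) auto
    also have "\<dots> \<le> (- (1 / d))\<^sup>2 * d"
      unfolding quad_scale using G by (intro mult_left_mono) auto
    also have "\<dots> = 1 / d"
      using pos by (simp add: power2_eq_square)
    finally have "quad H l ?x \<le> l - 1 / d"
      using G v pos unfolding quad by auto
    with \<open>?x v = 1\<close> show ?thesis by (intro exI[of _ ?x] conjI)
  qed
  moreover have "(l' - 1 / d') * (y v)\<^sup>2 \<le> quad H l' y" for y
    using quadratic_lower_bound[OF pos(2), of "y v" "y r"] lb[of y] unfolding quad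
    by (simp add: algebra_simps)
  ultimately show ?thesis unfolding attainable_def by blast
qed

text \<open>In this form the sign of \<open>tri l d - d\<close> and the dependence on
  \<open>l\<close> are visible; \<open>tri_altdef\<close> is the Schur complement itself and shows
  the dependence on \<open>d\<close>.\<close>

definition tri :: "real \<Rightarrow> real \<Rightarrow> real" where
  "tri l d = d + (l - 2) - (1 - d)\<^sup>2 / (d - l / (l\<^sup>2 - 1))"

lemma tri_altdef:
  assumes "d \<noteq> l / (l\<^sup>2 - 1)" and "u = l / (l\<^sup>2 - 1)"
  shows "tri l d = l - u - (1 - u)\<^sup>2 / (d - u)"
proof -
  have "d \<noteq> u" using assms by simp
  then show ?thesis
    unfolding tri_def assms(2)[symmetric] by (simp add: divide_simps) (simp add: algebra_simps power2_eq_square)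
qed

text \<open>
  The new root \<open>v\<close> and the old root \<open>r\<close> form a triangle with a vertex \<open>p\<close>, which carries a leaf
  \<open>w\<close>. Eliminating \<open>w\<close> and \<open>p\<close> subtracts \<open>u = 1 / (l - 1 / l)\<close> from all entries of the
  block of \<open>r\<close> and \<open>v\<close>.
\<close>

lemma attainable_tri:
  assumes att: "attainable l l' d d'" and "l > 1" "l' > 1"
    and pos: "d > l / (l\<^sup>2 - 1)" "d' > l' / (l'\<^sup>2 - 1)"
  shows "attainable l l' (tri l d) (tri l' d')"
proof -
  obtain G :: "nat pair_pre_digraph" and r x where G: "two_degenerate G" "r \<in> pverts G" "x r = 1" "quad G l x \<le> d"
    and lb: "\<And>y. d' * (y r)\<^sup>2 \<le> quad G l' y"
    using att unfolding attainable_def by blast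
  have pg: "pair_graph G" using two_degenerate_imp_pair_graph G by blast
  then obtain v where v: "v \<notin> pverts G"
    using ex_new_if_finite infinite_UNIV_nat by (auto simp: pair_graph_iff)
  define H1 where "H1 = add_vertex G v {r}"
  have deg1: "two_degenerate H1"
    unfolding H1_def using G v by (intro two_degenerate.add) auto
  then have pg1: "pair_graph H1" by (rule two_degenerate_imp_pair_graph)
  then obtain p where p: "p \<notin> pverts H1"
    using ex_new_if_finite infinite_UNIV_nat by (auto simp: pair_graph_iff)
  define H2 where "H2 = add_vertex H1 p {r, v}"
  have deg2: "two_degenerate H2"
    unfolding H2_def using deg1 G p by (intro two_degenerate.add) (auto simp: H1_def card_insert_if)
  then have pg2: "pair_graph H2" by (rule two_degenerate_imp_pair_graph)
  then obtain w where w: "w \<notin> pverts H2"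
    using ex_new_if_finite infinite_UNIV_nat by (auto simp: pair_graph_iff)
  define H where "H = add_vertex H2 w {p}"
  have "two_degenerate H"
    unfolding H_def using deg2 w by (intro two_degenerate.add) (auto simp: H2_def)
  moreover have "v \<in> pverts H" by (simp add: H_def H1_def H2_def)
  moreover have "r \<noteq> v" using G v by auto
  then have quad: "quad H m y = quad G m y + m * (y v)\<^sup>2 + 2 * y v * y r + m * (y p)\<^sup>2
      + 2 * y p * (y r + y v) + m * (y w)\<^sup>2 + 2 * y w * y p" for m y
    using quad_add_vertex[OF pg v, of "{r}"] quad_add_vertex[OF pg1 p, of "{r, v}"]
      quad_add_vertex[OF pg2 w, of "{p}"] G by (simp add: H_def H1_def H2_def)
  define u where "u = l / (l\<^sup>2 - 1)"
  define u' where "u' = l' / (l'\<^sup>2 - 1)"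
  have "l\<^sup>2 > 1" "l'\<^sup>2 > 1"
    using assms by (simp_all add: one_less_power)
  then have u: "u > 0" "l - 1 / l = 1 / u" and u': "u' > 0" "l' - 1 / l' = 1 / u'"
    using assms by (simp_all add: u_def u'_def diff_divide_distrib power2_eq_square)
  have "\<exists>x. x v = 1 \<and> quad H l x \<le> tri l d"
  proof -
    \<comment> \<open>The minimiser with value 1 at \<open>v\<close>: \<open>a\<close> at the old
      root minimises the form reduced by \<open>p\<close> and \<open>w\<close>, then
      \<open>s\<close> is optimal at \<open>p\<close>, and \<open>- s / l\<close> at
      \<open>w\<close>.\<close>
    define a where "a = - ((1 - u) / (d - u))"
    define s where "s = - u * (a + 1)"
    let ?x = "(\<lambda>u. a * x u)(v := 1, p := s, w := - s / l)"
    have "?x v = 1" using p w by (auto simp: H1_def H2_def)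
    have "quad G l ?x = quad G l (\<lambda>u. a * x u)"
      using v p w by (intro quad_cong[OF pg]) (auto simp: H1_def H2_def)
    also have "\<dots> \<le> a\<^sup>2 * d"
      unfolding quad_scale using G by (intro mult_left_mono) auto
    finally have "quad H l ?x \<le> a\<^sup>2 * d + l + 2 * a + l * s\<^sup>2 + 2 * s * (a + 1) + l * (- s / l)\<^sup>2 + 2 * (- s / l) * s"
      using G v p w unfolding quad by (auto simp: H1_def H2_def)
    also have "\<dots> = a\<^sup>2 * d + l + 2 * a + (l - 1 / l) * s\<^sup>2 + 2 * s * (a + 1)"
      using assms by (simp add: field_simps power2_eq_square)
    also have "\<dots> = (d - u) * a\<^sup>2 + 2 * (1 - u) * a + (l - u)"
      using u unfolding s_def u(2) by (simp add: field_simps power2_eq_square)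
    also have "\<dots> = tri l d"
    proof -
      have "d - u \<noteq> 0" using pos by (simp add: u_def)
      then have "a * (d - u) = - (1 - u)" by (simp add: a_def)
      have "(d - u) * a\<^sup>2 + 2 * (1 - u) * a = a * (a * (d - u)) + 2 * (1 - u) * a"
        by (simp add: power2_eq_square mult_ac)
      also have "\<dots> = (1 - u) * a"
        unfolding \<open>a * (d - u) = - (1 - u)\<close> by (simp add: algebra_simps)
      also have "\<dots> = - ((1 - u)\<^sup>2 / (d - u))"
        by (simp add: a_def power2_eq_square)
      finally show ?thesis
        using \<open>d - u \<noteq> 0\<close> by (simp add: tri_altdef[OF _ u_def] u_def[symmetric])
    qed
    finally have "quad H l ?x \<le> tri l d" .
    with \<open>?x v = 1\<close> show ?thesis by (intro exI[of _ ?x] conjI)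
  qed
  moreover have "tri l' d' * (y v)\<^sup>2 \<le> quad H l' y" for y
  proof -
    define s where "s = y r + y v"
    \<comment> \<open>\<open>1\<close>, \<open>2\<close> and \<open>3\<close> eliminate
      \<open>w\<close>, \<open>p\<close> and \<open>r\<close> in this order.\<close>
    have 1: "- ((y p)\<^sup>2 / l') \<le> l' * (y w)\<^sup>2 + 2 * y p * y w"
      using assms by (intro quadratic_lower_bound) auto
    have "- (s\<^sup>2 / (1 / u')) \<le> 1 / u' * (y p)\<^sup>2 + 2 * s * y p"
      using u' by (intro quadratic_lower_bound) auto
    then have 2: "- u' * s\<^sup>2 \<le> (l' - 1 / l') * (y p)\<^sup>2 + 2 * s * y p"
      unfolding u'(2) by (simp add: mult.commute[of u'])
    have "- (((1 - u') * y v)\<^sup>2 / (d' - u')) \<le> (d' - u') * (y r)\<^sup>2 + 2 * ((1 - u') * y v) * y r"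
      using pos by (intro quadratic_lower_bound) (auto simp: u'_def)
    then have 3: "tri l' d' * (y v)\<^sup>2 \<le> d' * (y r)\<^sup>2 + l' * (y v)\<^sup>2 + 2 * y v * y r - u' * s\<^sup>2"
      using pos by (subst tri_altdef[OF _ u'_def]) (auto simp: s_def algebra_simps power2_eq_square)
    show ?thesis
      using 1 2 3 lb[of y] unfolding quad s_def by (simp add: algebra_simps)
  qed
  ultimately show ?thesis unfolding attainable_def by blast
qed

lemma attainable_imp_smallest_eigenvalue:
  assumes "attainable l l' d d'" "d \<le> 0" "0 \<le> d'"
  shows "\<exists>G :: nat pair_pre_digraph. pair_graph G \<and> pverts G \<noteq> {} \<and> colorable 3 G \<and>
    - l' \<le> smallest_eigenvalue G \<and> smallest_eigenvalue G \<le> - l"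
proof -
  obtain G :: "nat pair_pre_digraph" and r x where G: "two_degenerate G" "r \<in> pverts G" "x r = 1" "quad G l x \<le> d"
    and lb: "\<And>y. d' * (y r)\<^sup>2 \<le> quad G l' y"
    using assms(1) unfolding attainable_def by blast
  have pg: "pair_graph G" using two_degenerate_imp_pair_graph G by blast
  have "0 \<le> quad G l' y" for y
    using lb[of y] assms(3) by (meson mult_nonneg_nonneg order_trans zero_le_power2)
  then have "- l' \<le> smallest_eigenvalue G"
    using G by (intro smallest_eigenvalue_ge[OF pg]) auto
  moreover have "smallest_eigenvalue G \<le> - l"
    using G assms by (intro smallest_eigenvalue_le[OF pg, of r x]) auto
  ultimately show ?thesis
    using pg G two_degenerate_imp_colorable[OF G(1)] by blast
qed

section \<open>Pendant paths and leaves\<close>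

text \<open>Closed bounds suffice, since \<open>theorem1p5\<close> places \<open>- k\<close> and
  \<open>- l'\<close> strictly inside its interval.\<close>

definition realizable :: "real \<Rightarrow> real \<Rightarrow> bool" where
  "realizable k l' \<longleftrightarrow> (\<exists>G :: nat pair_pre_digraph. pair_graph G \<and> pverts G \<noteq> {} \<and> colorable 3 G \<and>
    - l' \<le> smallest_eigenvalue G \<and> smallest_eigenvalue G \<le> - k)"

lemma add_inverse_strict_mono:
  fixes x y :: real
  assumes "1 < x" "x < y"
  shows "x + 1 / x < y + 1 / y"
proof -
  have "1 < x * y" using less_1_mult[of x y] assms by simp
  then have "(y - x) * 1 < (y - x) * (x * y)"
    using assms by (intro mult_strict_left_mono) auto
  then have "x * (x * y) + y < y * (x * y) + x"
    by (simp add: algebra_simps)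
  then show ?thesis
    using assms by (simp add: field_simps)
qed

lemma two_less_add_inverse:
  fixes x :: real
  assumes "1 < x"
  shows "2 < x + 1 / x"
proof -
  have "0 < (x - 1)\<^sup>2" using assms by simp
  then show ?thesis
    using assms by (simp add: field_simps power2_eq_square)
qed

text \<open>
  The three parameters stand for \<open>k < l < l'\<close> with \<open>k = s + 1 / s\<close> etc. The Moebius map
  \<open>d \<mapsto> l - 1 / d\<close> of a pendant step has the repelling fixed point \<open>1 / t\<close> and the
  attracting fixed point \<open>t\<close>.
\<close>

locale window =
  fixes s t t' :: real
  assumes one_less_s: "1 < s" and s_less_t: "s < t" and t_less_t': "t < t'"
begin

abbreviation "k \<equiv> s + 1 / s"
abbreviation "l \<equiv> t + 1 / t"
abbreviation "l' \<equiv> t' + 1 / t'"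

lemma one_less: "1 < s" "1 < t" "1 < t'"
  using one_less_s s_less_t t_less_t' by auto

lemma level_less: "2 < k" "k < l" "l < l'"
proof -
  show "k < l" "l < l'"
    using add_inverse_strict_mono one_less s_less_t t_less_t' by auto
  show "2 < k"
    using one_less by (intro two_less_add_inverse)
qed

lemma inverse_less: "1 / t < 1 / s" "1 / t' < 1 / t" "0 < 1 / t'" "1 / t < 1" "1 / t' < 1"
  using one_less s_less_t t_less_t' by (auto simp: divide_strict_left_mono)

text \<open>For \<open>0 < d < 1 / s\<close> a pendant step at level \<open>k\<close> multiplies the
  distance to \<open>1 / s\<close> by at least \<open>s^2\<close>, so the pivot eventually becomes
  nonpositive. At level \<open>l'\<close> it never falls below the fixed point
  \<open>1 / t'\<close>.\<close>

lemma pendant_path_realizable: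
  assumes "attainable k l' d d'" "d < 1 / s" "1 / t' \<le> d'"
  shows "realizable k l'"
proof -
  \<comment> \<open>\<open>n\<close> bounds the number of steps left: for \<open>n = 0\<close> the
    distance is at least \<open>1 / s\<close>, that is, \<open>d \<le> 0\<close>.\<close>
  have "realizable k l'"
    if "attainable k l' d d'" "1 / t' \<le> d'" "d < 1 / s" "1 / s \<le> (1 / s - d) * (s\<^sup>2) ^ n" for n d d'
    using that
  proof (induction n arbitrary: d d')
    case 0
    then have "d \<le> 0" by simp
    moreover have "0 \<le> d'" using 0 inverse_less by linarith
    ultimately show ?case
      unfolding realizable_def using attainable_imp_smallest_eigenvalue[OF 0(1)] by blast
  next
    case (Suc n)
    have d': "0 < d'" using Suc.prems inverse_less by linarith
    show ?case
    proof (cases "d \<le> 0")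
      case True
      then show ?thesis
        unfolding realizable_def using attainable_imp_smallest_eigenvalue[OF Suc.prems(1)] d' by force
    next
      case False
      then have d: "0 < d" by simp
      have "s * d < 1" using Suc.prems(3) one_less by (simp add: field_simps)
      then have "0 < 1 / s - d" using one_less by (simp add: field_simps)
      have "s\<^sup>2 * (1 / s - d) * d = s * (1 - s * d) * d"
        using one_less by (simp add: field_simps power2_eq_square)
      also have "\<dots> = (s * d) * (1 - s * d)" by simp
      also have "\<dots> \<le> 1 * (1 - s * d)"
        using \<open>s * d < 1\<close> by (intro mult_right_mono) auto
      finally have grow: "s\<^sup>2 * (1 / s - d) \<le> 1 / s - (k - 1 / d)"
        using d by (simp add: field_simps)
      then have "k - 1 / d < 1 / s"
        using \<open>0 < 1 / s - d\<close> one_less by (smt (verit) mult_pos_pos zero_less_power)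
      moreover have "1 / s \<le> (1 / s - (k - 1 / d)) * (s\<^sup>2) ^ n"
      proof -
        have "1 / s \<le> (s\<^sup>2 * (1 / s - d)) * (s\<^sup>2) ^ n"
          using Suc.prems(4) by (simp add: mult_ac)
        also have "\<dots> \<le> (1 / s - (k - 1 / d)) * (s\<^sup>2) ^ n"
          using grow by (intro mult_right_mono) auto
        finally show ?thesis .
      qed
      moreover have "1 / t' \<le> l' - 1 / d'"
        using Suc.prems(2) d' one_less by (simp add: field_simps)
      ultimately show ?thesis
        using attainable_pendant[OF Suc.prems(1) d d'] by (intro Suc.IH)
    qed
  qed
  moreover have pos: "0 < 1 / s - d" using assms by simp
  obtain n where "1 / s / (1 / s - d) < (s\<^sup>2) ^ n"
    using one_less real_arch_pow[of "s\<^sup>2"] by (auto simp: one_less_power)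
  then have "1 / s \<le> (1 / s - d) * (s\<^sup>2) ^ n"
    unfolding pos_divide_less_eq[OF pos] by (simp add: mult.commute)
  ultimately show ?thesis using assms by blast
qed

text \<open>The third level \<open>k\<close> serves here: a pivot that may equal
  \<open>1 / t\<close> at level \<open>l\<close> becomes one strictly below
  \<open>1 / s\<close>.\<close>

lemma realizable_if_straddles:
  assumes "attainable l l' d d'" "d \<le> 1 / t" "1 / t' \<le> d'"
  shows "realizable k l'"
proof (rule pendant_path_realizable)
  show "attainable k l' (d - (l - k)) d'"
    using attainable_decrease[OF assms(1)] level_less by simp
  show "d - (l - k) < 1 / s"
    using assms level_less inverse_less by linarith
qed (fact assms)

text \<open>Leaves are added while the first pivot stays above \<open>1 / t\<close>. When one more
  leaf would end this, it also takes the second pivot below \<open>1 / t'\<close>, since the window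
  is not realizable.\<close>

lemma reduce_by_leaves:
  assumes "attainable l l' v v'" "1 / t < v" "v < v'" and "\<not> realizable k l'"
  shows "\<exists>j::nat. attainable l l' (v - j * (1 / l)) (v' - j * (1 / l')) \<and>
    1 / t < v - j * (1 / l) \<and> v' - j * (1 / l') < 1 / t' + 1 / l'"
proof -
  have l: "0 < l" "0 < l'" using level_less by auto
  have "1 / l' < 1 / l" using level_less l by (intro divide_strict_left_mono) auto
  have "\<exists>j::nat. attainable l l' (v - j * (1 / l)) (v' - j * (1 / l')) \<and>
      1 / t < v - j * (1 / l) \<and> v' - j * (1 / l') < 1 / t' + 1 / l'"
    if "attainable l l' v v'" "1 / t < v" "v < v'" "v - 1 / t \<le> n * (1 / l)" for n :: nat and v v'
    using that
  proof (induction n arbitrary: v v')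
    case 0
    then show ?case by simp
  next
    case (Suc n)
    have leaf: "attainable l l' (v - 1 / l) (v' - 1 / l')"
      using Suc.prems(1) l by (rule attainable_leaf)
    show ?case
    proof (cases "v - 1 / l \<le> 1 / t")
      case True
      then have "v' - 1 / l' < 1 / t'"
        using realizable_if_straddles[OF leaf] assms(4) by linarith
      then show ?thesis
        using Suc.prems by (intro exI[of _ 0]) auto
    next
      case False
      have bound: "v - 1 / l - 1 / t \<le> n * (1 / l)"
        using Suc.prems(4) by (simp add: add_divide_distrib)
      have less: "v - 1 / l < v' - 1 / l'"
        using Suc.prems \<open>1 / l' < 1 / l\<close> by linarith
      from False obtain j :: nat where j: "attainable l l' (v - 1 / l - j * (1 / l)) (v' - 1 / l' - j * (1 / l'))"
          "1 / t < v - 1 / l - j * (1 / l)" "v' - 1 / l' - j * (1 / l') < 1 / t' + 1 / l'"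
        using Suc.IH[OF leaf] by (metis bound linorder_not_le less)
      have "x - y - j * y = x - Suc j * y" for x y :: real
        by (simp add: algebra_simps)
      then show ?thesis
        using j by (intro exI[of _ "Suc j"]) (simp only:)
    qed
  qed
  moreover obtain n :: nat where "(v - 1 / t) / (1 / l) \<le> n"
    using real_arch_simple by blast
  then have "v - 1 / t \<le> n * (1 / l)"
    using l pos_divide_le_eq[of "1 / l"] by simp
  ultimately show ?thesis using assms by blast
qed

end

text \<open>
  The number \<open>1 + ratio t d d' * (t - 1 / t)\<close> is the cross ratio of \<open>d\<close>, \<open>d'\<close> and the fixed
  points of \<open>d \<mapsto> l - 1 / d\<close>, which makes it invariant under that map.
\<close>

definition ratio :: "real \<Rightarrow> real \<Rightarrow> real \<Rightarrow> real" where
  "ratio t d d' = (d' - d) / ((t - d') * (d - 1 / t))"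

lemma ratio_pendant:
  assumes "0 < d" "0 < d'" "0 < t"
  shows "ratio t (t + 1 / t - 1 / d) (t + 1 / t - 1 / d') = ratio t d d'"
proof -
  have "(t - (t + 1 / t - 1 / d')) * (t + 1 / t - 1 / d - 1 / t) = (t - d') * (d - 1 / t) / (d * d')"
    using assms by (simp add: field_simps)
  moreover have "(t + 1 / t - 1 / d') - (t + 1 / t - 1 / d) = (d' - d) / (d * d')"
    using assms by (simp add: field_simps)
  ultimately show ?thesis
    using assms by (simp add: ratio_def)
qed

lemma ratio_mono:
  assumes "1 / t < d" "d < w" "w \<le> d'" "d' < t"
  shows "ratio t d w \<le> ratio t d d'"
  unfolding ratio_def using assms by (intro frac_le mult_right_mono mult_pos_pos) auto

text \<open>The shift changes only the denominator, from \<open>X\<close> to \<open>Y\<close>. Here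
  \<open>X - Y = j * (t + 1 / t + j - x - x')\<close> is at least \<open>c * \<delta>\<close>, while
  \<open>Y \<le> (t - 1 / t) * c\<close>.\<close>

lemma ratio_shift:
  assumes j: "c \<le> j" "0 < c" and x: "x < x'" "1 / t < x - j" "x' \<le> D" "x' - j < 1 / t + c" "D < t"
    and del: "0 < t + 1 / t + c - 2 * D"
  shows "(1 + (t + 1 / t + c - 2 * D) / (t - 1 / t)) * ratio t x x' \<le> ratio t (x - j) (x' - j)"
proof -
  define \<delta> where "\<delta> = t + 1 / t + c - 2 * D"
  define X where "X = (t - x') * (x - 1 / t)"
  define Y where "Y = (t - (x' - j)) * (x - j - 1 / t)"
  have "0 < t - 1 / t" using assms by linarith
  have "0 < Y" unfolding Y_def using assms by (intro mult_pos_pos) auto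
  have "0 < X" unfolding X_def using assms by (intro mult_pos_pos) auto
  have "Y \<le> (t - 1 / t) * c"
    unfolding Y_def using assms by (intro mult_mono) auto
  then have "Y * (\<delta> / (t - 1 / t)) \<le> (t - 1 / t) * c * (\<delta> / (t - 1 / t))"
    using del \<open>0 < t - 1 / t\<close> by (intro mult_right_mono) (auto simp: \<delta>_def)
  also have "\<dots> = c * \<delta>" using \<open>0 < t - 1 / t\<close> by simp
  also have "\<dots> \<le> j * (t + 1 / t + j - x - x')"
    using assms by (intro mult_mono) (auto simp: \<delta>_def)
  also have "\<dots> = X - Y"
    by (simp add: X_def Y_def algebra_simps add_divide_distrib diff_divide_distrib)
  finally have "Y * (1 + \<delta> / (t - 1 / t)) \<le> X"
    by (simp add: algebra_simps)
  then have "(x' - x) * (Y * (1 + \<delta> / (t - 1 / t))) \<le> (x' - x) * X"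
    using assms by (intro mult_left_mono) auto
  then have "(1 + \<delta> / (t - 1 / t)) * ((x' - x) / X) \<le> (x' - x) / Y"
    using \<open>0 < X\<close> \<open>0 < Y\<close> by (simp add: field_simps)
  then show ?thesis
    by (simp add: ratio_def X_def Y_def \<delta>_def)
qed

text \<open>Both differences are positive multiples of \<open>t ^ 4 - t^2 - 1\<close>; this is how
  the golden ratio enters as a threshold for \<open>t^2\<close>. The second bound is the condition
  of \<open>ratio_shift\<close> at the largest \<open>D\<close> that occurs.\<close>

lemma leaf_bounds:
  fixes t :: real
  assumes "1 < t" "0 < t ^ 4 - t\<^sup>2 - 1" and c: "c = 1 / (t + 1 / t)"
  shows "1 / t + c < t" "2 * (t + 1 / t - 1 / (1 / t + c)) < t + 1 / t + c"
proof -
  have t: "0 < t" "0 < t\<^sup>2" using assms by auto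
  have c_eq: "c = t / (t\<^sup>2 + 1)"
    unfolding c using t by (simp add: field_simps power2_eq_square)
  have "0 < t\<^sup>2 + 1" using t(2) by (rule add_pos_pos) simp
  have "c > 0" unfolding c_eq using t(1) \<open>0 < t\<^sup>2 + 1\<close> by (rule divide_pos_pos)
  have "t - (1 / t + c) = (t ^ 4 - t\<^sup>2 - 1) / (t * (t\<^sup>2 + 1))"
  proof -
    have "t \<noteq> 0" "t\<^sup>2 + 1 \<noteq> 0" using t \<open>0 < t\<^sup>2 + 1\<close> by linarith+
    then show ?thesis
      unfolding c_eq by (simp add: divide_simps) (simp add: algebra_simps power2_eq_square power4_eq_xxxx)
  qed
  also have "\<dots> > 0"
    by (rule divide_pos_pos[OF assms(2) mult_pos_pos[OF t(1) \<open>0 < t\<^sup>2 + 1\<close>]])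
  finally show "1 / t + c < t" by simp
  have "t + 1 / t = 1 / c" by (simp add: c)
  have ac: "1 / t + c = (2 * t\<^sup>2 + 1) / (t * (t\<^sup>2 + 1))"
    unfolding c_eq using t \<open>0 < t\<^sup>2 + 1\<close> by (simp add: field_simps power2_eq_square)
  have "t + 1 / t + c - 2 * (t + 1 / t - 1 / (1 / t + c)) = 2 / (1 / t + c) + c - (t + 1 / t)"
    by simp
  also have "\<dots> = (t ^ 4 - t\<^sup>2 - 1) / ((2 * t\<^sup>2 + 1) * (t * (t\<^sup>2 + 1)))"
  proof -
    have "2 / (1 / t + c) = 2 * (t * (t\<^sup>2 + 1)) / (2 * t\<^sup>2 + 1)"
      unfolding ac by simp
    moreover have "t + 1 / t = (t\<^sup>2 + 1) / t"
      using t by (simp add: field_simps power2_eq_square)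
    moreover have "2 * t\<^sup>2 + 1 \<noteq> 0" "t\<^sup>2 + 1 \<noteq> 0" "t \<noteq> 0"
      using t by linarith+
    then have "2 * (t * (t\<^sup>2 + 1)) / (2 * t\<^sup>2 + 1) + t / (t\<^sup>2 + 1) - (t\<^sup>2 + 1) / t =
        (t ^ 4 - t\<^sup>2 - 1) / ((2 * t\<^sup>2 + 1) * (t * (t\<^sup>2 + 1)))"
      by (simp add: divide_simps) (simp add: algebra_simps power2_eq_square power4_eq_xxxx)
    ultimately show ?thesis by (simp add: c_eq)
  qed
  also have "\<dots> > 0"
    using t by (intro divide_pos_pos[OF assms(2)] mult_pos_pos add_pos_pos) auto
  finally show "2 * (t + 1 / t - 1 / (1 / t + c)) < t + 1 / t + c" by simp
qed

context window
begin

text \<open>A round is one pendant step followed by leaves, and leads back to pivots in the interval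
  from \<open>1 / t\<close> to \<open>1 / t + c\<close>. Rounds without leaves keep
  \<open>ratio\<close> from dropping and push \<open>d\<close> away from \<open>1 / t\<close>, so
  only finitely many follow each other. Rounds with leaves multiply \<open>ratio\<close> by at least
  \<open>\<kappa>\<close> but require it to be at most \<open>K\<close>.\<close>

lemma realizable_by_leaves:
  assumes golden: "0 < t ^ 4 - t\<^sup>2 - 1"
  shows "realizable k l'"
proof (rule ccontr)
  assume unreal: "\<not> realizable k l'"
  define c where "c = 1 / l"
  define c' where "c' = 1 / l'"
  \<comment> \<open>\<open>D\<close> bounds the level \<open>l\<close> image under a pendant step,
    \<open>K\<close> bounds \<open>ratio\<close> before a round with leaves, and \<open>g\<close> is
    the least factor \<open>t / d\<close> by which a pendant step stretches
    \<open>d - 1 / t\<close>.\<close>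
  define D where "D = l - 1 / (1 / t + c)"
  define \<kappa> where "\<kappa> = 1 + (l + c - 2 * D) / (t - 1 / t)"
  define K where "K = t / ((t - D) * c)"
  define g where "g = t / (1 / t + c)"
  note less = one_less level_less inverse_less
  have c: "0 < c" "c' < c"
    using less unfolding c_def c'_def by (auto intro!: divide_strict_left_mono mult_pos_pos)
  have act: "1 / t + c < t" and D2: "2 * D < l + c"
    using leaf_bounds[OF less(2) golden c_def] by (auto simp: D_def)
  have "1 / t < 1 / (1 / t + c)"
    using act c less by (intro divide_strict_left_mono mult_pos_pos add_pos_pos) auto
  then have "D < t" by (simp add: D_def)
  have "0 < (l + c - 2 * D) / (t - 1 / t)"
    using D2 less by (intro divide_pos_pos) linarith+
  then have "1 < \<kappa>" by (simp add: \<kappa>_def)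
  have "0 < 1 / t + c" using c less by (intro add_pos_pos) auto
  then have "1 < g" using act by (simp add: g_def less_divide_eq)
  have step: "\<exists>e e'. attainable l l' e e' \<and> 1 / t < e \<and> e < e' \<and> e' \<le> 1 / t + c \<and>
      (ratio t d d' \<le> ratio t e e' \<and> (d - 1 / t) * g \<le> e - 1 / t \<or>
       ratio t d d' \<le> K \<and> \<kappa> * ratio t d d' \<le> ratio t e e')"
    if att: "attainable l l' d d'" and d: "1 / t < d" "d < d'" "d' \<le> 1 / t + c" for d d'
  proof -
    have pos: "0 < d" "0 < d'" "0 < t" using d less by linarith+
    define x where "x = l - 1 / d"
    \<comment> \<open>The second pivot is moved at level \<open>l\<close> too, so that
      \<open>ratio_pendant\<close> applies; the true pivot at level \<open>l'\<close> is larger, and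
      \<open>ratio_mono\<close> covers the gap.\<close>
    define x' where "x' = l - 1 / d'"
    have x: "1 / t < x" "x < x'"
    proof -
      have "1 / d < t" using d pos by (simp add: field_simps)
      then show "1 / t < x" by (simp add: x_def)
      have "1 / d' < 1 / d" using d pos by (intro divide_strict_left_mono) auto
      then show "x < x'" by (simp add: x_def x'_def)
    qed
    have "x' \<le> D"
      unfolding x'_def D_def using d pos by (intro diff_mono divide_left_mono) auto
    have rat: "ratio t x x' = ratio t d d'"
      unfolding x_def x'_def using pos by (intro ratio_pendant)
    have "x' < l' - 1 / d'" using less by (simp add: x'_def)
    then obtain j :: nat where j: "attainable l l' (x - j * c) (l' - 1 / d' - j * c')"
        "1 / t < x - j * c" "l' - 1 / d' - j * c' < 1 / t' + c'"
      using reduce_by_leaves[OF _ x(1) _ unreal, of "l' - 1 / d'"] attainable_pendant[OF att pos(1,2)] x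
      unfolding c_def c'_def x_def by auto
    define e where "e = x - j * c"
    define w where "w = x' - j * c"
    define e' where "e' = l' - 1 / d' - j * c'"
    have "j * c' \<le> j * c" using c by (intro mult_left_mono) auto
    then have "w \<le> e'" using \<open>x' < l' - 1 / d'\<close> by (simp add: w_def e'_def)
    have "e < w" using x by (simp add: e_def w_def)
    have "e' \<le> 1 / t + c" using j(3) c less by (simp add: e'_def)
    have mono: "ratio t e w \<le> ratio t e e'"
      using j(2) \<open>e < w\<close> \<open>w \<le> e'\<close> \<open>e' \<le> 1 / t + c\<close> act by (intro ratio_mono) (auto simp: e_def)
    have "ratio t d d' \<le> ratio t e e' \<and> (d - 1 / t) * g \<le> e - 1 / t \<or>
        ratio t d d' \<le> K \<and> \<kappa> * ratio t d d' \<le> ratio t e e'"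
    proof (cases "j = 0")
      case True
      then have "ratio t d d' \<le> ratio t e e'"
        using mono rat by (simp add: e_def w_def)
      moreover have "(d - 1 / t) * g \<le> (d - 1 / t) * (t / d)"
        unfolding g_def using d pos by (intro mult_left_mono divide_left_mono mult_pos_pos) auto
      moreover have "(d - 1 / t) * (t / d) = e - 1 / t"
        using True pos by (simp add: e_def x_def field_simps)
      ultimately show ?thesis by simp
    next
      case False
      then have "c \<le> j * c" using c by simp
      then have "1 / t + c < x" using j(2) by simp
      have "ratio t x x' \<le> K"
        unfolding ratio_def K_def
      proof (rule frac_le)
        show "x' - x \<le> t" using \<open>x' \<le> D\<close> \<open>D < t\<close> x less by linarith
        show "(t - D) * c \<le> (t - x') * (x - 1 / t)"
          using \<open>x' \<le> D\<close> \<open>D < t\<close> \<open>1 / t + c < x\<close> c by (intro mult_mono) auto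
      qed (use \<open>D < t\<close> c pos in auto)
      moreover have "\<kappa> * ratio t x x' \<le> ratio t e w"
        unfolding \<kappa>_def e_def w_def
        using \<open>c \<le> j * c\<close> c(1) x j(2) \<open>x' \<le> D\<close> \<open>D < t\<close> D2 \<open>w \<le> e'\<close> \<open>e' \<le> 1 / t + c\<close> j(3) c(2) less
        by (intro ratio_shift) (auto simp: w_def e'_def)
      ultimately show ?thesis using rat mono by simp
    qed
    then show ?thesis
      using j \<open>e < w\<close> \<open>w \<le> e'\<close> \<open>e' \<le> 1 / t + c\<close>
      by (intro exI[of _ e] exI[of _ e'] conjI) (auto simp: e_def e'_def)
  qed
  \<comment> \<open>Lexicographic descent: \<open>N\<close> bounds the remaining rounds with leaves,
    and \<open>M\<close> the rounds without leaves before the next one; \<open>M\<close> is chosen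
    anew whenever \<open>N\<close> drops.\<close>
  have False
    if "attainable l l' d d'" "1 / t < d" "d < d'" "d' \<le> 1 / t + c"
      "K < ratio t d d' * \<kappa> ^ N" "c < (d - 1 / t) * g ^ M" for N M d d'
    using that
  proof (induction N arbitrary: M d d' rule: less_induct)
    case (less N)
    from less.prems show False
    proof (induction M arbitrary: d d')
      case 0
      then show False by simp
    next
      case (Suc M)
      obtain e e' where e: "attainable l l' e e'" "1 / t < e" "e < e'" "e' \<le> 1 / t + c"
        and alt: "ratio t d d' \<le> ratio t e e' \<and> (d - 1 / t) * g \<le> e - 1 / t \<or>
          ratio t d d' \<le> K \<and> \<kappa> * ratio t d d' \<le> ratio t e e'"
        using step[OF Suc.prems(1-4)] by blast
      from alt show False
      proof
        assume *: "ratio t d d' \<le> ratio t e e' \<and> (d - 1 / t) * g \<le> e - 1 / t"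
        then have "ratio t d d' * \<kappa> ^ N \<le> ratio t e e' * \<kappa> ^ N"
          using \<open>1 < \<kappa>\<close> by (intro mult_right_mono) auto
        moreover have "(d - 1 / t) * g * g ^ M \<le> (e - 1 / t) * g ^ M"
          using * \<open>1 < g\<close> by (intro mult_right_mono) auto
        ultimately show False
          using e Suc.prems by (intro Suc.IH[OF e]) (auto simp: mult.assoc)
      next
        assume *: "ratio t d d' \<le> K \<and> \<kappa> * ratio t d d' \<le> ratio t e e'"
        then obtain N' where N: "N = Suc N'"
          using Suc.prems(5) by (cases N) auto
        have "\<kappa> * ratio t d d' * \<kappa> ^ N' \<le> ratio t e e' * \<kappa> ^ N'"
          using * \<open>1 < \<kappa>\<close> by (intro mult_right_mono) auto
        then have "K < ratio t e e' * \<kappa> ^ N'"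
          using Suc.prems(5) by (simp add: N mult_ac)
        moreover obtain M' where "c / (e - 1 / t) < g ^ M'"
          using real_arch_pow[OF \<open>1 < g\<close>] by blast
        then have "c < (e - 1 / t) * g ^ M'"
          using e by (simp add: pos_divide_less_eq mult.commute)
        ultimately show False
          using less.IH[OF _ e, of N' M'] N by simp
      qed
    qed
  qed
  note contra = this
  have "1 / t < l" using less by linarith
  then obtain j :: nat where j: "attainable l l' (l - j * c) (l' - j * c')" "1 / t < l - j * c" "l' - j * c' < 1 / t' + c'"
    using reduce_by_leaves[OF attainable_single _ level_less(3) unreal] unfolding c_def c'_def by auto
  define d where "d = l - j * c"
  define d' where "d' = l' - j * c'"
  have "j * c' \<le> j * c" using c by (intro mult_left_mono) auto
  then have d: "attainable l l' d d'" "1 / t < d" "d < d'" "d' \<le> 1 / t + c"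
    using j less c by (auto simp: d_def d'_def)
  then have "0 < ratio t d d'"
    unfolding ratio_def using act by (intro divide_pos_pos mult_pos_pos) auto
  obtain N where "K / ratio t d d' < \<kappa> ^ N"
    using real_arch_pow[OF \<open>1 < \<kappa>\<close>] by blast
  then have "K < ratio t d d' * \<kappa> ^ N"
    using \<open>0 < ratio t d d'\<close> by (simp add: pos_divide_less_eq mult.commute)
  moreover obtain M where "c / (d - 1 / t) < g ^ M"
    using real_arch_pow[OF \<open>1 < g\<close>] by blast
  then have "c < (d - 1 / t) * g ^ M"
    using d by (simp add: pos_divide_less_eq mult.commute)
  ultimately show False
    using contra[OF d] by blast
qed

end

section \<open>Triangles\<close>

lemma tri_level_eq:
  fixes x :: real
  assumes "0 < x"
  shows "(x + 1 / x) / ((x + 1 / x)\<^sup>2 - 1) = (x ^ 3 + x) / (x ^ 4 + x\<^sup>2 + 1)"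
proof -
  have "(x + 1 / x)\<^sup>2 - 1 = (x ^ 4 + x\<^sup>2 + 1) / x\<^sup>2"
    using assms by (simp add: field_simps power2_eq_square power4_eq_xxxx)
  moreover have "x + 1 / x = (x ^ 3 + x) / x\<^sup>2"
    using assms by (simp add: field_simps power2_eq_square power3_eq_cube)
  ultimately show ?thesis using assms by simp
qed

text \<open>With \<open>tri_level_eq\<close> this makes the triangle step available for every pivot
  above \<open>1 / x\<close>.\<close>

lemma tri_level_less_inverse:
  fixes x :: real
  assumes "0 < x"
  shows "(x ^ 3 + x) / (x ^ 4 + x\<^sup>2 + 1) < 1 / x"
proof -
  have "0 < x ^ 4 + x\<^sup>2 + 1" using assms by (intro add_pos_pos) auto
  moreover have "(x ^ 3 + x) * x < x ^ 4 + x\<^sup>2 + 1"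
    by (simp add: algebra_simps power_numeral_reduce)
  ultimately show ?thesis using assms by (simp add: divide_simps)
qed

lemma tri_level_antimono:
  fixes m n :: real
  assumes "1 < m" "m < n"
  shows "n / (n\<^sup>2 - 1) < m / (m\<^sup>2 - 1)"
proof -
  have "0 < m\<^sup>2 - 1" "0 < n\<^sup>2 - 1"
    using assms by (simp_all add: one_less_power)
  moreover have "0 < (n - m) * (m * n + 1)"
    using assms by (intro mult_pos_pos add_pos_pos) auto
  then have "n * (m\<^sup>2 - 1) < m * (n\<^sup>2 - 1)"
    by (simp add: algebra_simps power2_eq_square)
  ultimately show ?thesis by (simp add: divide_simps)
qed

lemma tri_mono:
  assumes "1 < m" "m \<le> n" "m / (m\<^sup>2 - 1) < d"
  shows "tri m d \<le> tri n d - (n - m)"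
proof -
  have "n / (n\<^sup>2 - 1) \<le> m / (m\<^sup>2 - 1)"
    using tri_level_antimono[of m n] assms by (cases "m = n") auto
  then have "(1 - d)\<^sup>2 / (d - n / (n\<^sup>2 - 1)) \<le> (1 - d)\<^sup>2 / (d - m / (m\<^sup>2 - 1))"
    using assms by (intro divide_left_mono mult_pos_pos) auto
  then show ?thesis by (simp add: tri_def)
qed

text \<open>The preimage of the repelling fixed point \<open>1 / x\<close> under the triangle step.\<close>

lemma tri_preimage:
  fixes x :: real
  assumes "0 < x"
  defines "e \<equiv> (2 * x ^ 4 - 2 * x ^ 3 + 2 * x\<^sup>2 - 2 * x + 1) / x ^ 5"
  shows "(x ^ 3 + x) / (x ^ 4 + x\<^sup>2 + 1) < e" "tri (x + 1 / x) e = 1 / x"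
proof -
  define q where "q = x ^ 4 + x\<^sup>2 + 1"
  \<comment> \<open>\<open>r\<close> is \<open>(x ^ 5 + 1) / (x + 1)\<close>. Both
    \<open>1 - u = r / q\<close> and \<open>e - u = r^2 / (q * x ^ 5)\<close> factor through it, so
    it cancels in \<open>tri\<close>.\<close>
  define r where "r = x ^ 4 - x ^ 3 + x\<^sup>2 - x + 1"
  define u where "u = (x ^ 3 + x) / q"
  have "0 < q" using assms unfolding q_def by (intro add_pos_pos) auto
  have "0 < x + 1" using assms by simp
  moreover have "r * (x + 1) = x ^ 5 + 1"
    by (simp add: r_def algebra_simps power_numeral_reduce)
  moreover have "0 < x ^ 5 + 1" using assms by (intro add_pos_pos) auto
  ultimately have "0 < r" by (metis zero_less_mult_pos2)
  have "e - u = ((2 * x ^ 4 - 2 * x ^ 3 + 2 * x\<^sup>2 - 2 * x + 1) * q - (x ^ 3 + x) * x ^ 5) / (q * x ^ 5)"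
    using assms \<open>0 < q\<close> by (simp add: e_def u_def diff_frac_eq mult_ac)
  also have "(2 * x ^ 4 - 2 * x ^ 3 + 2 * x\<^sup>2 - 2 * x + 1) * q - (x ^ 3 + x) * x ^ 5 = r\<^sup>2"
    by (simp add: q_def r_def algebra_simps power_numeral_reduce)
  finally have eu: "e - u = r\<^sup>2 / (q * x ^ 5)" .
  then have "u < e"
    using \<open>0 < r\<close> \<open>0 < q\<close> assms by (smt (verit) divide_pos_pos mult_pos_pos zero_less_power)
  then show "(x ^ 3 + x) / (x ^ 4 + x\<^sup>2 + 1) < e" by (simp add: u_def q_def)
  have "1 - u = r / q"
    using \<open>0 < q\<close> by (simp add: u_def r_def q_def field_simps)
  then have "(1 - u)\<^sup>2 / (e - u) = (r / q)\<^sup>2 / (r\<^sup>2 / (q * x ^ 5))"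
    by (simp only: eu)
  also have "\<dots> = x ^ 5 / q"
    using \<open>0 < r\<close> \<open>0 < q\<close> by (simp add: field_simps power2_eq_square)
  finally have "(1 - u)\<^sup>2 / (e - u) = x ^ 5 / q" .
  moreover have "x - u = x ^ 5 / q"
    using \<open>0 < q\<close> by (simp add: u_def q_def field_simps power_numeral_reduce)
  moreover have "u = (x + 1 / x) / ((x + 1 / x)\<^sup>2 - 1)"
    using tri_level_eq[OF assms(1)] by (simp add: u_def q_def)
  ultimately show "tri (x + 1 / x) e = 1 / x"
    using \<open>u < e\<close> by (subst tri_altdef[of _ _ u]) auto
qed

text \<open>
  The line \<open>bnd\<close> lies, for \<open>23 / 20 \<le> x \<le> 51 / 40\<close>, between two curves: above the image under
  the pendant step of the preimage of \<open>1 / x\<close> under the triangle step, and below the repelling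
  fixed point of the triangle step. It also lies above the pivots of the two starting paths. Its coefficients were found numerically.
\<close>

definition bnd :: "real \<Rightarrow> real" where
  "bnd x = 681 / 500 - 19 / 50 * x"

text \<open>Bounds the powers in the expansions below linearly on a short interval, which leaves
  linear arithmetic.\<close>

lemma power_le_linear:
  fixes y h :: real
  assumes "0 \<le> y" "y \<le> h"
  shows "y ^ Suc n \<le> h ^ n * y"
  using mult_right_mono[OF power_mono[OF assms(2,1)] assms(1), of n] by (simp add: mult.commute)

text \<open>This is \<open>tri (x + 1 / x) (bnd x) \<le> bnd x\<close> with denominators
  cleared.\<close>

lemma bnd_tri_poly:
  fixes x :: real
  assumes "23 / 20 \<le> x" "x \<le> 51 / 40"
  shows "(x - 1)\<^sup>2 * (bnd x * (x ^ 4 + x\<^sup>2 + 1) - (x ^ 3 + x)) \<le> (1 - bnd x)\<^sup>2 * (x * (x ^ 4 + x\<^sup>2 + 1))"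
proof -
  define y where "y = x - 23 / 20"
  have y: "0 \<le> y" "y \<le> 1 / 8" and x: "x = 23 / 20 + y"
    using assms by (simp_all add: y_def)
  have "(1 - bnd x)\<^sup>2 * (x * (x ^ 4 + x\<^sup>2 + 1)) - ((x - 1)\<^sup>2 * (bnd x * (x ^ 4 + x\<^sup>2 + 1) - (x ^ 3 + x))) =
      8673381 / 5120000000 - 79755051 / 6400000000 * y + 469923973 / 8000000000 * y ^ 2
        + 111840161 / 80000000 * y ^ 3 + 7875819 / 4000000 * y ^ 4 + 556643 / 200000 * y ^ 5
        + 18243 / 10000 * y ^ 6 + 1311 / 2500 * y ^ 7"
    unfolding x bnd_def by (simp add: field_simps power_numeral_reduce)
  also have "0 \<le> \<dots>"
    using y zero_le_power[OF y(1), of 3] zero_le_power[OF y(1), of 4] zero_le_power[OF y(1), of 5]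
      zero_le_power[OF y(1), of 6] zero_le_power[OF y(1), of 7] zero_le_power2[of "y - 1 / 10"]
    by (simp add: numeral_eq_Suc)
  finally show ?thesis by simp
qed

text \<open>This is \<open>x + 1 / x - 1 / e \<le> bnd x\<close> for the preimage \<open>e\<close>
  of \<open>tri_preimage\<close>, with denominators cleared.\<close>

lemma bnd_pendant_poly:
  fixes x :: real
  assumes "23 / 20 \<le> x" "x \<le> 51 / 40"
  shows "(x\<^sup>2 + 1) * (2 * x ^ 4 - 2 * x ^ 3 + 2 * x\<^sup>2 - 2 * x + 1) - x ^ 6
    \<le> bnd x * x * (2 * x ^ 4 - 2 * x ^ 3 + 2 * x\<^sup>2 - 2 * x + 1)"
proof -
  define y where "y = x - 23 / 20"
  have y: "0 \<le> y" "y \<le> 1 / 8" and x: "x = 23 / 20 + y"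
    using assms by (simp_all add: y_def)
  have "bnd x * x * (2 * x ^ 4 - 2 * x ^ 3 + 2 * x\<^sup>2 - 2 * x + 1) - ((x\<^sup>2 + 1) * (2 * x ^ 4 - 2 * x ^ 3 + 2 * x\<^sup>2 - 2 * x + 1) - x ^ 6) =
      1463091 / 32000000 + 8179019 / 40000000 * y - 7621 / 3125 * y ^ 2 - 79513 / 10000 * y ^ 3
        - 2173 / 200 * y ^ 4 - 333 / 50 * y ^ 5 - 44 / 25 * y ^ 6"
    unfolding x bnd_def by (simp add: field_simps power_numeral_reduce)
  also have "0 \<le> \<dots>"
    using y power_le_linear[OF y, of 1] power_le_linear[OF y, of 2] power_le_linear[OF y, of 3]
      power_le_linear[OF y, of 4] power_le_linear[OF y, of 5]
    by (simp add: numeral_eq_Suc)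
  finally show ?thesis by simp
qed

text \<open>Bounds the starting pivot of \<open>chain_eqs(2)\<close> by the line;
  \<open>bnd_head3_poly\<close> does so for \<open>chain_eqs(3)\<close>.\<close>

lemma bnd_head2_poly:
  fixes x :: real
  assumes "23 / 20 \<le> x" "x \<le> 303 / 250"
  shows "(x ^ 4 + x\<^sup>2 + 1)\<^sup>2 - (x ^ 3 + x)\<^sup>2 \<le> bnd x * ((x ^ 3 + x) * (x ^ 4 + x\<^sup>2 + 1))"
proof -
  define y where "y = x - 23 / 20"
  have y: "0 \<le> y" "y \<le> 31 / 500" and x: "x = 23 / 20 + y"
    using assms by (simp_all add: y_def)
  have "bnd x * ((x ^ 3 + x) * (x ^ 4 + x\<^sup>2 + 1)) - ((x ^ 4 + x\<^sup>2 + 1)\<^sup>2 - (x ^ 3 + x)\<^sup>2) =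
      31503772577 / 51200000000 - 206203357309 / 32000000000 * y - 68065215531 / 1600000000 * y ^ 2
        - 7595556441 / 80000000 * y ^ 3 - 46985957 / 400000 * y ^ 4 - 3565083 / 40000 * y ^ 5
        - 418973 / 10000 * y ^ 6 - 5667 / 500 * y ^ 7 - 69 / 50 * y ^ 8"
    unfolding x bnd_def by (simp add: field_simps power_numeral_reduce)
  also have "0 \<le> \<dots>"
    using y power_le_linear[OF y, of 1] power_le_linear[OF y, of 2] power_le_linear[OF y, of 3]
      power_le_linear[OF y, of 4] power_le_linear[OF y, of 5] power_le_linear[OF y, of 6]
      power_le_linear[OF y, of 7]
    by (simp add: numeral_eq_Suc)
  finally show ?thesis by simp
qed

lemma bnd_head3_poly:
  fixes x :: real
  assumes "303 / 250 \<le> x" "x \<le> 51 / 40"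
  shows "x ^ 8 + x ^ 4 + 1 \<le> bnd x * (x ^ 7 + x ^ 5 + x ^ 3 + x)"
proof -
  \<comment> \<open>The rounder center 6/5, left of the interval, keeps \<open>y\<close>
    nonnegative.\<close>
  define y where "y = x - 6 / 5"
  have y: "0 \<le> y" "y \<le> 3 / 40" and x: "x = 6 / 5 + y"
    using assms by (simp_all add: y_def)
  have "bnd x * (x ^ 7 + x ^ 5 + x ^ 3 + x) - (x ^ 8 + x ^ 4 + 1) =
      15236929 / 19531250 - 45678267 / 7812500 * y - 15582677 / 390625 * y ^ 2
        - 28822143 / 312500 * y ^ 3 - 14919 / 125 * y ^ 4 - 1171587 / 12500 * y ^ 5
        - 27863 / 625 * y ^ 6 - 5943 / 500 * y ^ 7 - 69 / 50 * y ^ 8"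
    unfolding x bnd_def by (simp add: field_simps power_numeral_reduce)
  also have "0 \<le> \<dots>"
    using y power_le_linear[OF y, of 1] power_le_linear[OF y, of 2] power_le_linear[OF y, of 3]
      power_le_linear[OF y, of 4] power_le_linear[OF y, of 5] power_le_linear[OF y, of 6]
      power_le_linear[OF y, of 7]
    by (simp add: numeral_eq_Suc)
  finally show ?thesis by simp
qed

text \<open>The difference quotient of \<open>tri m\<close> is
  \<open>(1 - u)^2 / ((d - u) * (d' - u))\<close>, and both factors below are at most
  \<open>b - u \<le> b * (1 - u)\<close>.\<close>

lemma tri_diff:
  assumes "0 < u" "u < 1" "u = m / (m\<^sup>2 - 1)" "u < d" "d \<le> d'" "d' \<le> b" "b < 1"
  shows "(d' - d) / b\<^sup>2 \<le> tri m d' - tri m d"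
proof -
  have pos: "0 < d - u" "0 < d' - u" "0 < b" using assms by auto
  have le: "e - u \<le> b * (1 - u)" if "e \<le> b" for e
  proof -
    have "b * u \<le> 1 * u" using assms by (intro mult_right_mono) auto
    with that show ?thesis by (simp add: algebra_simps)
  qed
  have "(d - u) * (d' - u) \<le> (b * (1 - u)) * (b * (1 - u))"
    using assms pos by (intro mult_mono le) auto
  then have "(d' - d) * ((d - u) * (d' - u)) \<le> (d' - d) * ((1 - u)\<^sup>2 * b\<^sup>2)"
    using assms by (intro mult_left_mono) (auto simp: power2_eq_square mult_ac)
  then have "(d' - d) / b\<^sup>2 \<le> (d' - d) * (1 - u)\<^sup>2 / ((d - u) * (d' - u))"
    using pos by (subst frac_le_eq) (auto simp: divide_simps mult_ac)
  also have "\<dots> = (1 - u)\<^sup>2 / (d - u) - (1 - u)\<^sup>2 / (d' - u)"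
    using pos by (simp add: diff_frac_eq) (simp add: algebra_simps)
  also have "\<dots> = tri m d' - tri m d"
    using assms by (simp add: tri_altdef[of _ m u])
  finally show ?thesis .
qed

lemma tri_mono_root:
  assumes "m / (m\<^sup>2 - 1) < d" "d \<le> d'"
  shows "tri m d \<le> tri m d'"
proof -
  define u where "u = m / (m\<^sup>2 - 1)"
  have "(1 - u)\<^sup>2 / (d' - u) \<le> (1 - u)\<^sup>2 / (d - u)"
    using assms by (intro divide_left_mono mult_pos_pos) (auto simp: u_def)
  then show ?thesis
    using assms by (simp add: tri_altdef[OF _ u_def] u_def)
qed

text \<open>By monotonicity in \<open>d\<close> only \<open>d = bnd x\<close> matters, where
  \<open>tri_def\<close> reduces the claim to \<open>bnd_tri_poly\<close>.\<close>

lemma tri_bounded: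
  fixes x d :: real
  assumes x: "23 / 20 \<le> x" "x \<le> 51 / 40"
    and d: "(x ^ 3 + x) / (x ^ 4 + x\<^sup>2 + 1) < d" "d \<le> bnd x"
  shows "tri (x + 1 / x) d \<le> bnd x"
proof -
  define q where "q = x ^ 4 + x\<^sup>2 + 1"
  define u where "u = (x ^ 3 + x) / q"
  have "0 < q" using x unfolding q_def by (intro add_pos_pos) auto
  have u_eq: "(x + 1 / x) / ((x + 1 / x)\<^sup>2 - 1) = u"
    using tri_level_eq[of x] x by (simp add: u_def q_def)
  have "u < bnd x" using d by (simp add: u_def q_def)
  have "(x - 1)\<^sup>2 / x * (bnd x - u) = (x - 1)\<^sup>2 * (bnd x * q - (x ^ 3 + x)) / (x * q)"
    using x \<open>0 < q\<close> by (simp add: u_def field_simps)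
  also have "\<dots> \<le> (1 - bnd x)\<^sup>2"
    using bnd_tri_poly[OF x] x \<open>0 < q\<close> by (simp add: pos_divide_le_eq q_def)
  finally have "(x - 1)\<^sup>2 / x \<le> (1 - bnd x)\<^sup>2 / (bnd x - u)"
    using \<open>u < bnd x\<close> by (simp add: pos_le_divide_eq)
  moreover have "x + 1 / x - 2 = (x - 1)\<^sup>2 / x"
    using x by (simp add: field_simps power2_eq_square)
  ultimately have "tri (x + 1 / x) (bnd x) \<le> bnd x"
    by (simp add: tri_def u_eq)
  moreover have "tri (x + 1 / x) d \<le> tri (x + 1 / x) (bnd x)"
    using d by (intro tri_mono_root) (auto simp: u_eq u_def q_def)
  ultimately show ?thesis by simp
qed

text \<open>If a triangle would overshoot, \<open>d\<close> lies below the preimage \<open>e\<close>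
  of \<open>1 / x\<close>, so its pendant image lies below that of \<open>e\<close>.\<close>

lemma pendant_bounded:
  fixes x d :: real
  assumes x: "23 / 20 \<le> x" "x \<le> 51 / 40"
    and d: "0 < d" "tri (x + 1 / x) d < 1 / x"
  shows "x + 1 / x - 1 / d \<le> bnd x"
proof -
  define p where "p = 2 * x ^ 4 - 2 * x ^ 3 + 2 * x\<^sup>2 - 2 * x + 1"
  define e where "e = p / x ^ 5"
  have "0 < x" using x by simp
  have e: "(x ^ 3 + x) / (x ^ 4 + x\<^sup>2 + 1) < e" "tri (x + 1 / x) e = 1 / x"
    using tri_preimage[OF \<open>0 < x\<close>] by (simp_all add: e_def p_def)
  have "0 < (x ^ 3 + x) / (x ^ 4 + x\<^sup>2 + 1)"
    using \<open>0 < x\<close> by (intro divide_pos_pos add_pos_pos) auto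
  then have "0 < e" using e by linarith
  then have "0 < p" using \<open>0 < x\<close> by (simp add: e_def zero_less_divide_iff)
  have "d < e"
  proof (rule ccontr)
    assume "\<not> d < e"
    then have "tri (x + 1 / x) e \<le> tri (x + 1 / x) d"
      using e \<open>0 < x\<close> by (intro tri_mono_root) (auto simp: tri_level_eq)
    with e d show False by simp
  qed
  then have "x + 1 / x - 1 / d \<le> x + 1 / x - 1 / e"
    using d by (intro diff_left_mono divide_left_mono) auto
  also have "\<dots> = ((x\<^sup>2 + 1) * p - x ^ 6) / (x * p)"
  proof -
    have "1 / e = x ^ 5 / p" by (simp add: e_def)
    moreover have "x + 1 / x = (x\<^sup>2 + 1) / x"
      using \<open>0 < x\<close> by (simp add: field_simps power2_eq_square)
    ultimately show ?thesis
      using \<open>0 < x\<close> \<open>0 < p\<close> by (simp add: diff_frac_eq power_numeral_reduce mult_ac)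
  qed
  also have "\<dots> \<le> bnd x"
    using bnd_pendant_poly[OF x] \<open>0 < x\<close> \<open>0 < p\<close> by (simp add: pos_divide_le_eq p_def mult_ac)
  finally show ?thesis .
qed

section \<open>Starting paths and the expansion by triangles\<close>

lemma inverse_less_frac:
  fixes t A B :: real
  assumes "0 < t" "0 < B" "B < t * A"
  shows "1 / t < A / B"
  using assms by (simp add: divide_simps mult.commute)

text \<open>Pivots after one, two and three pendant steps from a single vertex, the last two with a
  leaf added at the root.\<close>

lemma chain_eqs:
  fixes x :: real
  assumes "0 < x"
  defines "m \<equiv> x + 1 / x" and "q \<equiv> x ^ 4 + x\<^sup>2 + 1" and "w \<equiv> x ^ 3 + x"
  shows "m - 1 / m = q / w"
    and "m - 1 / (m - 1 / m) - 1 / m = (q\<^sup>2 - w\<^sup>2) / (w * q)"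
    and "m - 1 / (m - 1 / (m - 1 / m)) - 1 / m = (x ^ 8 + x ^ 4 + 1) / (x ^ 7 + x ^ 5 + x ^ 3 + x)"
proof -
  have pos: "0 < q" "0 < w" "0 < m"
    using assms(1) unfolding q_def w_def m_def by (auto intro!: add_pos_pos)
  have m: "m = w / x\<^sup>2"
    using assms(1) by (simp add: m_def w_def field_simps power_numeral_reduce)
  have "m - 1 / m = (w\<^sup>2 - (x\<^sup>2)\<^sup>2) / (w * x\<^sup>2)"
    unfolding m using pos assms(1) by (simp add: diff_frac_eq power2_eq_square)
  also have "w\<^sup>2 - (x\<^sup>2)\<^sup>2 = q * x\<^sup>2"
    by (simp add: w_def q_def algebra_simps power_numeral_reduce)
  finally show 1: "m - 1 / m = q / w" using assms(1) by simp
  have 2: "m - 1 / (m - 1 / m) = m - w / q" by (simp add: 1)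
  have "m - w / q - 1 / m = q / w - w / q" using 1 by simp
  also have "\<dots> = (q\<^sup>2 - w\<^sup>2) / (w * q)"
    using pos by (simp add: diff_frac_eq power2_eq_square)
  finally show "m - 1 / (m - 1 / m) - 1 / m = (q\<^sup>2 - w\<^sup>2) / (w * q)" unfolding 2 .
  define v where "v = x ^ 6 + x ^ 4 + x\<^sup>2 + 1"
  have "0 < v" using assms(1) unfolding v_def by (intro add_pos_pos) auto
  have "m - w / q = (w * q - w * x\<^sup>2) / (x\<^sup>2 * q)"
    unfolding m using pos assms(1) by (simp add: diff_frac_eq)
  also have "w * q - w * x\<^sup>2 = v * x"
    by (simp add: w_def q_def v_def algebra_simps power_numeral_reduce)
  finally have 3: "m - w / q = v / (x * q)"
    using assms(1) by (simp add: power2_eq_square)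
  have "m - 1 / (m - w / q) - 1 / m = q / w - x * q / v"
    using 1 unfolding 3 by simp
  also have "\<dots> = (q * v - x * q * w) / (w * v)"
    using pos \<open>0 < v\<close> by (simp add: diff_frac_eq mult_ac)
  also have "\<dots> = (x ^ 8 + x ^ 4 + 1) / (x ^ 7 + x ^ 5 + x ^ 3 + x)"
  proof -
    have "0 < x ^ 7 + x ^ 5 + x ^ 3 + x" using assms(1) by (intro add_pos_pos) auto
    then have ne: "x ^ 7 + x ^ 5 + x ^ 3 + x \<noteq> 0" by simp
    have "(q * v - x * q * w) * (x ^ 7 + x ^ 5 + x ^ 3 + x) = (x ^ 8 + x ^ 4 + 1) * (w * v)"
      by (simp add: w_def q_def v_def algebra_simps power_numeral_reduce)
    moreover have "w * v \<noteq> 0" using pos \<open>0 < v\<close> by simp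
    ultimately show ?thesis using frac_eq_eq[OF _ ne] by blast
  qed
  finally show "m - 1 / (m - 1 / (m - 1 / m)) - 1 / m = (x ^ 8 + x ^ 4 + 1) / (x ^ 7 + x ^ 5 + x ^ 3 + x)"
    unfolding 2 .
qed

context window
begin

text \<open>A triangle is attached if it keeps \<open>d\<close> above \<open>1 / t\<close>,
  otherwise a pendant edge. Either step keeps \<open>d'\<close> below \<open>b < 1\<close> and
  multiplies \<open>d' - d\<close> by at least \<open>1 / b^2 > 1\<close>, although this distance
  stays below \<open>b\<close>.\<close>

lemma realizable_by_triangles:
  assumes t: "23 / 20 \<le> t" "t' \<le> 51 / 40"
    and init: "attainable l l' d d'" "1 / t < d" "d < d'" "d' \<le> bnd t'"
  shows "realizable k l'"
proof (rule ccontr)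
  assume unreal: "\<not> realizable k l'"
  define b where "b = bnd t'"
  define u where "u = l / (l\<^sup>2 - 1)"
  define u' where "u' = l' / (l'\<^sup>2 - 1)"
  note less = one_less level_less inverse_less
  have b: "0 < b" "b < 1"
    using t less t_less_t' by (auto simp: b_def bnd_def)
  have u': "u' = (t' ^ 3 + t') / (t' ^ 4 + t'\<^sup>2 + 1)"
    using tri_level_eq[of t'] less by (simp add: u'_def)
  have u: "u < 1 / t" "u' < u" "0 < u'" "u' < 1"
  proof -
    show "u < 1 / t"
      using tri_level_eq[of t] tri_level_less_inverse[of t] less by (simp add: u_def)
    show "u' < u"
      unfolding u_def u'_def using less by (intro tri_level_antimono) auto
    show "0 < u'"
      unfolding u' using less by (intro divide_pos_pos add_pos_pos) auto
    show "u' < 1"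
      using \<open>u < 1 / t\<close> \<open>u' < u\<close> less by linarith
  qed
  have step: "\<exists>e e'. attainable l l' e e' \<and> 1 / t < e \<and> e < e' \<and> e' \<le> b \<and> (d' - d) / b\<^sup>2 \<le> e' - e"
    if att: "attainable l l' d d'" and d: "1 / t < d" "d < d'" "d' \<le> b" for d d'
  proof -
    have pos: "u < d" "u' < d" "u' < d'" "0 < d" "0 < d'" using d u by linarith+
    have att_tri: "attainable l l' (tri l d) (tri l' d')"
      using pos less by (intro attainable_tri[OF att]) (auto simp: u_def u'_def)
    show ?thesis
    proof (cases "tri l d \<le> 1 / t")
      case True
      \<comment> \<open>As the window is not realizable, the triangle overshoots at level
        \<open>l'\<close> as well, which is what \<open>pendant_bounded\<close> requires.\<close>
      then have "tri l' d' < 1 / t'"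
        using realizable_if_straddles[OF att_tri] unreal by linarith
      then have "l' - 1 / d' \<le> b"
        unfolding b_def using pos t t_less_t' by (intro pendant_bounded) auto
      moreover have "1 / t < l - 1 / d"
      proof -
        have "1 / d < t" using d pos less by (simp add: field_simps)
        then show ?thesis by simp
      qed
      moreover have "(d' - d) / b\<^sup>2 \<le> 1 / d - 1 / d'"
      proof -
        have "d * d' \<le> b * b" using d pos b by (intro mult_mono) auto
        then have "(d' - d) / b\<^sup>2 \<le> (d' - d) / (d * d')"
          using d pos b by (intro divide_left_mono) (auto simp: power2_eq_square)
        also have "\<dots> = 1 / d - 1 / d'"
          using pos by (simp add: field_simps)
        finally show ?thesis .
      qed
      moreover have "0 < (d' - d) / b\<^sup>2" using d b by simp
      ultimately show ?thesis
        using attainable_pendant[OF att pos(4,5)] less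
        by (intro exI[of _ "l - 1 / d"] exI[of _ "l' - 1 / d'"]) auto
    next
      case False
      have "tri l' d' \<le> b"
        unfolding b_def using d pos t t_less_t' by (intro tri_bounded) (auto simp: u' b_def)
      moreover have "tri l d \<le> tri l' d - (l' - l)"
        using less pos by (intro tri_mono) (auto simp: u_def)
      moreover have "(d' - d) / b\<^sup>2 \<le> tri l' d' - tri l' d"
        using d pos b by (intro tri_diff[OF u(3) u(4) u'_def]) auto
      moreover have "0 < (d' - d) / b\<^sup>2" using d b by simp
      ultimately show ?thesis
        using att_tri less False
        by (intro exI[of _ "tri l d"] exI[of _ "tri l' d'"]) auto
    qed
  qed
  have False
    if "attainable l l' d d'" "1 / t < d" "d < d'" "d' \<le> b" "b < (d' - d) * (1 / b\<^sup>2) ^ n" for n d d'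
    using that
  proof (induction n arbitrary: d d')
    case 0
    moreover have "0 < 1 / t" using less by simp
    ultimately show False by (simp only: power_0 mult_1_right)
  next
    case (Suc n)
    obtain e e' where e: "attainable l l' e e'" "1 / t < e" "e < e'" "e' \<le> b" "(d' - d) / b\<^sup>2 \<le> e' - e"
      using step[OF Suc.prems(1-4)] by blast
    have "(d' - d) / b\<^sup>2 * (1 / b\<^sup>2) ^ n \<le> (e' - e) * (1 / b\<^sup>2) ^ n"
      using e b by (intro mult_right_mono) auto
    then have "b < (e' - e) * (1 / b\<^sup>2) ^ n"
      using Suc.prems(5) by (simp add: mult.assoc)
    with e(1-4) show False by (rule Suc.IH)
  qed
  note contra = this
  have "1 < 1 / b\<^sup>2"
    using b by (simp add: power_strict_decreasing[of 0 2 b, simplified] abs_square_less_1)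
  then obtain n where "b / (d' - d) < (1 / b\<^sup>2) ^ n"
    using real_arch_pow by blast
  then have "b < (d' - d) * (1 / b\<^sup>2) ^ n"
    using init by (simp only: pos_divide_less_eq[of "d' - d"] mult.commute diff_gt_0_iff_gt)
  with contra init show False by (simp only: b_def)
qed

lemma pendant_less:
  assumes "0 < d" "d < d'"
  shows "l - 1 / d < l' - 1 / d'"
  using assms level_less(3) by (intro diff_strict_mono divide_strict_left_mono) auto

lemma realizable_by_head2:
  assumes "1 < t\<^sup>2 * (t\<^sup>2 * t\<^sup>2 - 1)" "23 / 20 \<le> t" "t' \<le> 303 / 250"
  shows "realizable k l'"
proof -
  note less = one_less level_less inverse_less
  have "1 < l - 1 / l"
  proof -
    have "1 / l < 1" using less by simp
    then show ?thesis using less by linarith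
  qed
  then have pos: "0 < l" "0 < l'" "0 < l - 1 / l"
    using less by linarith+
  have "l - 1 / l < l' - 1 / l'"
    using pendant_less pos level_less by blast
  then have pos': "0 < l' - 1 / l'" using pos by linarith
  define d where "d = l - 1 / (l - 1 / l) - 1 / l"
  define d' where "d' = l' - 1 / (l' - 1 / l') - 1 / l'"
  have "attainable l l' d d'"
    unfolding d_def d'_def using pos pos' by (intro attainable_leaf attainable_pendant attainable_single)
  moreover have "1 / t < d"
  proof -
    define q where "q = t ^ 4 + t\<^sup>2 + 1"
    define w where "w = t ^ 3 + t"
    have "0 < w * q" using less unfolding w_def q_def by (intro mult_pos_pos add_pos_pos) auto
    \<comment> \<open>With \<open>z = t^2\<close> the difference of the two sides below is
      \<open>t * z * (z ^ 3 - z - 1)\<close>, whose last factor is the defining polynomial of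
      \<open>rho\<close>.\<close>
    moreover have "0 < t * (t\<^sup>2 * (t\<^sup>2 * (t\<^sup>2 * t\<^sup>2 - 1) - 1))" using assms less by simp
    then have "w * q < t * (q\<^sup>2 - w\<^sup>2)"
      by (simp add: w_def q_def algebra_simps power_numeral_reduce)
    moreover have "d = (q\<^sup>2 - w\<^sup>2) / (w * q)"
      unfolding d_def w_def q_def using less by (intro chain_eqs(2)) simp
    ultimately show ?thesis using less(2) by (simp add: inverse_less_frac)
  qed
  moreover have "d < d'"
  proof -
    have "1 / l' < 1 / l" using pos less by (intro divide_strict_left_mono) auto
    then show ?thesis
      unfolding d_def d'_def
      using pendant_less[OF pos(3) \<open>l - 1 / l < l' - 1 / l'\<close>] by linarith
  qed
  moreover have "d' \<le> bnd t'"
  proof -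
    have t': "23 / 20 \<le> t'" using assms t_less_t' by simp
    then have "0 < (t' ^ 3 + t') * (t' ^ 4 + t'\<^sup>2 + 1)"
      by (intro mult_pos_pos add_pos_pos) auto
    moreover have "d' = ((t' ^ 4 + t'\<^sup>2 + 1)\<^sup>2 - (t' ^ 3 + t')\<^sup>2) / ((t' ^ 3 + t') * (t' ^ 4 + t'\<^sup>2 + 1))"
      unfolding d'_def using less by (intro chain_eqs(2)) simp
    ultimately show ?thesis
      using bnd_head2_poly[OF t' assms(3)] by (simp only: pos_divide_le_eq)
  qed
  ultimately show ?thesis
    using assms by (intro realizable_by_triangles[of d d']) auto
qed

text \<open>A third pendant step lowers the starting pivots and so keeps them under the line beyond
  303/250. The condition \<open>1 / t < d\<close> now reads \<open>z ^ 3 - z^2 - 1 > 0\<close> for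
  \<open>z = t^2\<close>.\<close>

lemma realizable_by_head3:
  assumes "303 / 250 \<le> t" "t' \<le> 51 / 40"
  shows "realizable k l'"
proof -
  note less = one_less level_less inverse_less
  have "1 < l - 1 / l"
  proof -
    have "1 / l < 1" using less by simp
    then show ?thesis using less by linarith
  qed
  then have pos: "0 < l" "0 < l'" "0 < l - 1 / l"
    using less by linarith+
  have less2: "l - 1 / l < l' - 1 / l'"
    using pendant_less pos level_less by blast
  have "1 / (l - 1 / l) < 1" using \<open>1 < l - 1 / l\<close> by simp
  then have pos3: "0 < l - 1 / (l - 1 / l)" using less by linarith
  have less3: "l - 1 / (l - 1 / l) < l' - 1 / (l' - 1 / l')"
    using pendant_less[OF pos(3) less2] .
  have pos': "0 < l' - 1 / l'" "0 < l' - 1 / (l' - 1 / l')"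
    using pos pos3 less2 less3 by linarith+
  define d where "d = l - 1 / (l - 1 / (l - 1 / l)) - 1 / l"
  define d' where "d' = l' - 1 / (l' - 1 / (l' - 1 / l')) - 1 / l'"
  have "attainable l l' d d'"
    unfolding d_def d'_def using pos pos3 pos' by (intro attainable_leaf attainable_pendant attainable_single)
  moreover have "1 / t < d"
  proof -
    have "0 < t" using less by simp
    have "303 / 250 * (303 / 250) \<le> t * t" using assms by (intro mult_mono) auto
    \<comment> \<open>The bound is 1.468, just above the real root 1.4656 of
      \<open>z ^ 3 = z^2 + 1\<close>.\<close>
    then have z: "73 / 50 + 4 / 500 \<le> t\<^sup>2" by (simp add: power2_eq_square)
    then have "(73 / 50 + 4 / 500)\<^sup>2 * (23 / 50 + 4 / 500) \<le> (t\<^sup>2)\<^sup>2 * (t\<^sup>2 - 1)"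
      by (intro mult_mono power_mono) auto
    then have "1 < (t\<^sup>2)\<^sup>2 * (t\<^sup>2 - 1)" by (simp add: power2_eq_square)
    then have "0 < t\<^sup>2 * ((t\<^sup>2)\<^sup>2 * (t\<^sup>2 - 1) - 1)" using \<open>0 < t\<close> by simp
    then have "t ^ 7 + t ^ 5 + t ^ 3 + t < t * (t ^ 8 + t ^ 4 + 1)"
      using \<open>0 < t\<close> mult_pos_pos[of t "t\<^sup>2 * ((t\<^sup>2)\<^sup>2 * (t\<^sup>2 - 1) - 1)"]
      by (simp add: algebra_simps power_numeral_reduce)
    moreover have "0 < t ^ 7 + t ^ 5 + t ^ 3 + t" using \<open>0 < t\<close> by (intro add_pos_pos) auto
    moreover have "d = (t ^ 8 + t ^ 4 + 1) / (t ^ 7 + t ^ 5 + t ^ 3 + t)"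
      unfolding d_def using less by (intro chain_eqs(3)) simp
    ultimately show ?thesis using \<open>0 < t\<close> by (simp add: inverse_less_frac)
  qed
  moreover have "d < d'"
  proof -
    have "1 / l' < 1 / l" using pos less by (intro divide_strict_left_mono) auto
    then show ?thesis
      unfolding d_def d'_def using pendant_less[OF pos3 less3] by linarith
  qed
  moreover have "d' \<le> bnd t'"
  proof -
    have t': "303 / 250 \<le> t'" using assms t_less_t' by simp
    then have "0 < t' ^ 7 + t' ^ 5 + t' ^ 3 + t'"
      by (intro add_pos_pos) auto
    moreover have "d' = (t' ^ 8 + t' ^ 4 + 1) / (t' ^ 7 + t' ^ 5 + t' ^ 3 + t')"
      unfolding d'_def using less by (intro chain_eqs(3)) simp
    ultimately show ?thesis
      using bnd_head3_poly[OF t' assms(2)] by (simp only: pos_divide_le_eq)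
  qed
  ultimately show ?thesis
    using assms by (intro realizable_by_triangles[of d d']) auto
qed

end

text \<open>The bound 529/400 is the square of 23/20, so \<open>sqrt rho\<close> is not left of the
  range of the \<open>bnd\<close> estimates.\<close>

lemma rho_props: "rho ^ 3 = 1 + rho" "529 / 400 \<le> rho"
proof -
  show root: "rho ^ 3 = 1 + rho"
    unfolding rho_def by (rule theI'[OF ex1_rho])
  have "\<exists>x::real. 529 / 400 \<le> x \<and> x \<le> 2 \<and> x ^ 3 - x = 1"
    by (rule IVT') (auto intro!: continuous_intros simp: power3_eq_cube)
  then obtain x :: real where "529 / 400 \<le> x" "x ^ 3 = 1 + x"
    by (auto simp: algebra_simps)
  with root show "529 / 400 \<le> rho"
    using ex1_rho by blast
qed

section \<open>Density\<close>

theorem theorem1p5: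
  fixes lam eps :: real
  assumes "lam > lambda_star" and "eps > 0"
  shows "\<exists>G :: nat pair_pre_digraph.
           pair_graph G \<and> pverts G \<noteq> {} \<and> colorable 3 G \<and>
           smallest_eigenvalue G \<in> {- lam - eps <..< - lam}"
proof -
  have "0 < rho" using rho_props by linarith
  then have star: "lambda_star = sqrt rho + 1 / sqrt rho"
    by (simp add: lambda_star_def powr_half_sqrt powr_minus_divide)
  have root: "23 / 20 \<le> sqrt rho"
    using rho_props(2) by (intro real_le_rsqrt) (simp add: power2_eq_square)
  have "2 < lambda_star"
    unfolding star using root by (intro two_less_add_inverse) linarith
  then have "2 < lam" using assms by simp
  \<comment> \<open>\<open>\<tau>\<close> is the larger solution of
    \<open>\<tau> + 1 / \<tau> = lam\<close>.\<close>
  define r where "r = sqrt (lam\<^sup>2 - 4)"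
  define \<tau> where "\<tau> = (lam + r) / 2"
  have sq: "0 < lam\<^sup>2 - 4"
    using \<open>2 < lam\<close> power_strict_mono[of 2 lam 2] by simp
  have "0 < r" "r\<^sup>2 = lam\<^sup>2 - 4" using sq by (simp_all add: r_def)
  then have "1 < \<tau>" using \<open>2 < lam\<close> by (simp add: \<tau>_def)
  have "\<tau> * (lam - \<tau>) = (lam\<^sup>2 - r\<^sup>2) / 4"
    by (simp add: \<tau>_def field_simps power2_eq_square)
  also have "\<dots> = 1" using \<open>r\<^sup>2 = lam\<^sup>2 - 4\<close> by simp
  finally have lam: "lam = \<tau> + 1 / \<tau>"
    using \<open>1 < \<tau>\<close> by (simp add: field_simps)
  have "sqrt rho < \<tau>"
  proof (rule ccontr)
    assume "\<not> sqrt rho < \<tau>"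
    then have "lam \<le> lambda_star"
      using add_inverse_strict_mono[OF \<open>1 < \<tau>\<close>, of "sqrt rho"] unfolding star lam
      by (cases "\<tau> = sqrt rho") auto
    with assms show False by simp
  qed
  \<comment> \<open>It suffices to realize windows just right of \<open>\<tau>\<close>:
    \<open>s > \<tau>\<close> gives the strict bound at \<open>lam\<close>, and since
    \<open>1 / t'\<close> does not exceed \<open>1 / \<tau>\<close>, the other end moves by at most
    \<open>\<delta> < eps\<close>.\<close>
  have main: ?thesis
    if "0 < \<delta>" "\<delta> < eps" and real: "\<And>s t t'. \<tau> < s \<Longrightarrow> s < t \<Longrightarrow> t < t' \<Longrightarrow> t' \<le> \<tau> + \<delta> \<Longrightarrow>
      window s t t' \<Longrightarrow> realizable (s + 1 / s) (t' + 1 / t')" for \<delta>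
  proof -
    define s where "s = \<tau> + \<delta> / 4"
    define t where "t = \<tau> + \<delta> / 2"
    define t' where "t' = \<tau> + \<delta>"
    have *: "\<tau> < s" "s < t" "t < t'" using that by (auto simp: s_def t_def t'_def)
    then have "window s t t'" using \<open>1 < \<tau>\<close> by unfold_locales auto
    then have "realizable (s + 1 / s) (t' + 1 / t')"
      using * by (intro real) (auto simp: t'_def)
    then obtain G :: "nat pair_pre_digraph" where G: "pair_graph G" "pverts G \<noteq> {}" "colorable 3 G"
      "- (t' + 1 / t') \<le> smallest_eigenvalue G" "smallest_eigenvalue G \<le> - (s + 1 / s)"
      unfolding realizable_def by blast
    have "lam < s + 1 / s"
      unfolding lam using add_inverse_strict_mono[OF \<open>1 < \<tau>\<close> *(1)] .
    moreover have "1 / t' \<le> 1 / \<tau>" using * \<open>1 < \<tau>\<close> by (intro divide_left_mono) auto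
    then have "t' + 1 / t' < lam + eps" unfolding lam using that by (simp add: t'_def)
    ultimately have "smallest_eigenvalue G \<in> {- lam - eps <..< - lam}" using G by auto
    with G show ?thesis by blast
  qed
  \<comment> \<open>303/250 is just above the threshold of the longer starting path, and 51/40 just
    above the square root of the golden ratio, where leaves take over.\<close>
  consider "\<tau> < 303 / 250" | "303 / 250 \<le> \<tau>" "\<tau> < 51 / 40" | "51 / 40 \<le> \<tau>" by linarith
  then show ?thesis
  proof cases
    case 1
    show ?thesis
    proof (rule main[of "min (eps / 2) (303 / 250 - \<tau>)"])
      fix s t t' assume *: "\<tau> < s" "s < t" "t < t'" "t' \<le> \<tau> + min (eps / 2) (303 / 250 - \<tau>)" "window s t t'"
      have "rho < t\<^sup>2"
        using * \<open>sqrt rho < \<tau>\<close> \<open>0 < rho\<close> power_strict_mono[of "sqrt rho" t 2] by simp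
      moreover have "1 < rho" using rho_props(2) by simp
      moreover have "1 < rho * rho" using less_1_mult[OF \<open>1 < rho\<close> \<open>1 < rho\<close>] .
      moreover have "rho * rho < t\<^sup>2 * t\<^sup>2"
        using \<open>rho < t\<^sup>2\<close> \<open>0 < rho\<close> by (intro mult_strict_mono) auto
      ultimately have "rho * (rho * rho - 1) < t\<^sup>2 * (t\<^sup>2 * t\<^sup>2 - 1)"
        by (intro mult_strict_mono) auto
      moreover have "rho * (rho * rho - 1) = 1"
        using rho_props(1) by (simp add: power3_eq_cube algebra_simps)
      ultimately show "realizable (s + 1 / s) (t' + 1 / t')"
        using * \<open>sqrt rho < \<tau>\<close> root by (intro window.realizable_by_head2[of s t t']) auto
    qed (use 1 assms in auto)
  next
    case 2
    show ?thesis
    proof (rule main[of "min (eps / 2) (51 / 40 - \<tau>)"])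
      fix s t t' assume *: "\<tau> < s" "s < t" "t < t'" "t' \<le> \<tau> + min (eps / 2) (51 / 40 - \<tau>)" "window s t t'"
      then show "realizable (s + 1 / s) (t' + 1 / t')"
        using 2 by (intro window.realizable_by_head3[of s t t']) auto
    qed (use 2 assms in auto)
  next
    case 3
    show ?thesis
    proof (rule main[of "eps / 2"])
      fix s t t' assume *: "\<tau> < s" "s < t" "t < t'" "t' \<le> \<tau> + eps / 2" "window s t t'"
      have "51 / 40 * (51 / 40) \<le> t * t" using * 3 by (intro mult_mono) auto
      then have "13 / 8 \<le> t\<^sup>2" by (simp add: power2_eq_square)
      then have "13 / 8 * (5 / 8) \<le> t\<^sup>2 * (t\<^sup>2 - 1)" by (intro mult_mono) auto
      then have "0 < t ^ 4 - t\<^sup>2 - 1"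
        by (simp add: algebra_simps power_numeral_reduce)
      then show "realizable (s + 1 / s) (t' + 1 / t')"
        using * by (intro window.realizable_by_leaves[of s t t'])
    qed (use assms in auto)
  qed
qed

end
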